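(* Let $M=f^{-1}(\cos 4\theta)\subset S^{2l-1}$ be an isoparametric hypersurface of OT--FKM type associated with a symmetric Clifford system $\{P_0,\dots,P_m\}$ on $\mathbb{R}^{2l}$, with principal distributions $\mathcal{D}_1,\mathcal{D}_2,\mathcal{D}_3,\mathcal{D}_4$. If $m$ is odd, then there exists a global (real) vector bundle isomorphism over $M$ from $\mathcal{D}_1\oplus\mathcal{D}_2$ to $\mathcal{D}_3\oplus\mathcal{D}_4$.
   Context: A symmetric Clifford system on $\mathbb{R}^{2l}$ is an $(m+1)$-tuple $\{P_0,\dots,P_m\}$ ($m\ge 1$) of symmetric orthogonal $2l\times 2l$ real matrices satisfying $P_iP_j+P_jP_i=2\delta_{ij}I$. Put $F(x)=|x|^4-2\sum_{i=0}^m\langle P_ix,x\rangle^2$ on $\mathbb{R}^{2l}$ and $f=F|_{S^{2l-1}}$, where $S^{2l-1}$ is the unit sphere. An isoparametric hypersurface of OT--FKM type is a level set $M=f^{-1}(\cos 4\theta)$ for a constant $\theta\in(0,\pi/4)$; it has dimension $2l-2$. It is assumed that $m_1:=m$ and $m_2:=l-m-1$ are both positive. With respect to the unit normal $\xi=\nabla^S f/|\nabla^S f|$ ($\nabla^S$ the gradient on the sphere) and the shape operator $A_\xi$ given by $d\xi=-A_\xi$ on $TM$, $M$ has four distinct constant principal curvatures $\lambda_k=\cot(\theta+\frac{k-1}{4}\pi)$, $k=1,2,3,4$, with multiplicities $(m_1,m_2,m_1,m_2)$. The principal distribution $\mathcal{D}_k\subset TM$ is the eigenbundle of $A_\xi$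 for the eigenvalue $\lambda_k$. *)

theory Defs
  imports "HOL-Analysis.Analysis"
begin

section \<open>Smooth maps on subsets of Euclidean space\<close>

text \<open>\<open>Ck_on k f U\<close> is meant for open \<open>U\<close>: all iterated directional derivatives of \<open>f\<close> up to
  order \<open>k\<close> exist and are continuous.\<close>

primrec Ck_on :: "nat \<Rightarrow> ('a::euclidean_space \<Rightarrow> 'b::euclidean_space) \<Rightarrow> 'a set \<Rightarrow> bool" where
  "Ck_on 0 f U \<longleftrightarrow> continuous_on U f"
| "Ck_on (Suc k) f U \<longleftrightarrow>
     (\<forall>x\<in>U. f differentiable (at x)) \<and>
     (\<forall>v. Ck_on k (\<lambda>x. frechet_derivative f (at x) v) U)"

text \<open>A map on an arbitrary subset is smooth if it locally extends to a smooth map of the ambient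
  Euclidean space; on embedded submanifolds this is the usual notion.\<close>

definition smooth_on :: "('a::euclidean_space \<Rightarrow> 'b::euclidean_space) \<Rightarrow> 'a set \<Rightarrow> bool" where
  "smooth_on f A \<longleftrightarrow>
     (\<forall>p\<in>A. \<exists>U h. open U \<and> p \<in> U \<and> (\<forall>k. Ck_on k h U) \<and> (\<forall>q\<in>A \<inter> U. h q = f q))"


section \<open>Submanifolds of Euclidean space\<close>

text \<open>Velocities at \<open>x\<close> of \<open>C\<^sup>1\<close> curves that run in \<open>S\<close>.\<close>

definition tangent_space :: "'a::euclidean_space set \<Rightarrow> 'a \<Rightarrow> 'a set" where
  "tangent_space S x =
     {v. \<exists>e>0. \<exists>c :: real \<Rightarrow> 'a.
           c C1_differentiable_on {-e<..<e} \<and> c ` {-e<..<e} \<subseteq> S \<and>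
           c 0 = x \<and> (c has_vector_derivative v) (at 0)}"

text \<open>The derivative \<open>at x within S\<close> is in general not unique as a linear map on the ambient space,
  but its values on tangent vectors are, by the chain rule along curves in \<open>S\<close>. It depends only on
  the restriction of the map to \<open>S\<close>. So this is the differential of the restriction as long as \<open>v\<close>
  is tangent to \<open>S\<close>, which is the only case used below.\<close>

definition differential_on ::
    "'a::euclidean_space set \<Rightarrow> ('a \<Rightarrow> 'b::euclidean_space) \<Rightarrow> 'a \<Rightarrow> 'a \<Rightarrow> 'b" where
  "differential_on S h x v = frechet_derivative h (at x within S) v"

definition gradient_on :: "'a::euclidean_space set \<Rightarrow> ('a \<Rightarrow> real) \<Rightarrow> 'a \<Rightarrow> 'a" where
  "gradient_on S h x =
     (THE g. g \<in> tangent_space S x \<and> (\<forall>v\<in>tangent_space S x. differential_on S h x v = g \<bullet> v))"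


section \<open>Isoparametric hypersurfaces of OT--FKM type\<close>

definition clifford_system :: "nat \<Rightarrow> (nat \<Rightarrow> real^'n^'n) \<Rightarrow> bool" where
  "clifford_system m P \<longleftrightarrow> 1 \<le> m \<and>
     (\<forall>i\<le>m. transpose (P i) = P i \<and> orthogonal_matrix (P i)) \<and>
     (\<forall>i\<le>m. \<forall>j\<le>m. P i ** P j + P j ** P i = (if i = j then 2 else 0) *\<^sub>R mat 1)"

definition FKM_poly :: "nat \<Rightarrow> (nat \<Rightarrow> real^'n^'n) \<Rightarrow> real^'n \<Rightarrow> real" where
  "FKM_poly m P x = norm x ^ 4 - 2 * (\<Sum>i\<le>m. ((P i *v x) \<bullet> x)\<^sup>2)"

definition FKM_hypersurface :: "nat \<Rightarrow> (nat \<Rightarrow> real^'n^'n) \<Rightarrow> real \<Rightarrow> (real^'n) set" where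
  "FKM_hypersurface m P \<theta> = {x \<in> sphere 0 1. FKM_poly m P x = cos (4 * \<theta>)}"

definition unit_normal :: "nat \<Rightarrow> (nat \<Rightarrow> real^'n^'n) \<Rightarrow> real^'n \<Rightarrow> real^'n" where
  "unit_normal m P x =
     (let g = gradient_on (sphere 0 1) (FKM_poly m P) x in (1 / norm g) *\<^sub>R g)"

definition shape_operator ::
    "nat \<Rightarrow> (nat \<Rightarrow> real^'n^'n) \<Rightarrow> real \<Rightarrow> real^'n \<Rightarrow> real^'n \<Rightarrow> real^'n" where
  "shape_operator m P \<theta> x v = - differential_on (FKM_hypersurface m P \<theta>) (unit_normal m P) x v"

definition principal_curvature :: "real \<Rightarrow> nat \<Rightarrow> real" where
  "principal_curvature \<theta> k = cot (\<theta> + (real k - 1) / 4 * pi)"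

definition principal_distribution ::
    "nat \<Rightarrow> (nat \<Rightarrow> real^'n^'n) \<Rightarrow> real \<Rightarrow> nat \<Rightarrow> real^'n \<Rightarrow> (real^'n) set" where
  "principal_distribution m P \<theta> k x =
     {v \<in> tangent_space (FKM_hypersurface m P \<theta>) x.
        shape_operator m P \<theta> x v = principal_curvature \<theta> k *\<^sub>R v}"


section \<open>Vector bundle isomorphisms\<close>

text \<open>A subbundle of a trivial bundle over \<open>M\<close> is given by its fibres \<open>E x\<close>, \<open>x \<in> M\<close>; its total space
  is \<open>Sigma M E\<close>. The Whitney sum is the fibrewise (external) direct sum.\<close>

definition whitney_sum :: "('a \<Rightarrow> 'b set) \<Rightarrow> ('a \<Rightarrow> 'c set) \<Rightarrow> 'a \<Rightarrow> ('b \<times> 'c) set" where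
  "whitney_sum E E' x = E x \<times> E' x"

definition vector_bundle_iso ::
    "'a::euclidean_space set \<Rightarrow> ('a \<Rightarrow> 'b::euclidean_space set) \<Rightarrow> ('a \<Rightarrow> 'c::euclidean_space set)
      \<Rightarrow> ('a \<times> 'b \<Rightarrow> 'a \<times> 'c) \<Rightarrow> bool" where
  "vector_bundle_iso M E E' \<Phi> \<longleftrightarrow>
     bij_betw \<Phi> (Sigma M E) (Sigma M E') \<and>
     smooth_on \<Phi> (Sigma M E) \<and>
     smooth_on (inv_into (Sigma M E) \<Phi>) (Sigma M E') \<and>
     (\<forall>p\<in>Sigma M E. fst (\<Phi> p) = fst p) \<and>
     (\<forall>x\<in>M. \<forall>u\<in>E x. \<forall>v\<in>E x. \<forall>a b.
        snd (\<Phi> (x, a *\<^sub>R u + b *\<^sub>R v)) = a *\<^sub>R snd (\<Phi> (x, u)) + b *\<^sub>R snd (\<Phi> (x, v)))"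

end

theory Submission
  imports Defs
begin

text \<open>
  Write \<open>s = sin 2\<theta>\<close> and let \<open>M\<close> be the hypersurface. It consists of the unit vectors \<open>x\<close> whose vector
  of moments \<open>a\<^sub>i = \<langle>P\<^sub>i x, x\<rangle>\<close> has length \<open>s\<close>. Hence every \<open>x \<in> M\<close> singles out one symmetric
  orthogonal involution \<open>R\<^sub>x = (1/s) \<Sum> a\<^sub>i P\<^sub>i\<close> of the unit sphere of the Clifford system, and
  \<open>\<langle>R\<^sub>x x, x\<rangle> = s\<close>. The tangent space \<open>T\<close> of \<open>M\<close> at \<open>x\<close> is the orthogonal complement of \<open>x\<close> and
  \<open>R\<^sub>x x\<close>, the unit normal is \<open>(s x - R\<^sub>x x) / cos 2\<theta>\<close>, and differentiating it shows that the principal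
  spaces are the eigenspaces in \<open>T\<close> of \<open>R\<^sub>x + (2/s) W\<close>. Here \<open>W\<close> is the orthogonal projection
  onto the vectors \<open>P\<^sub>i x\<close>, and the eigenvalues are \<open>cot \<theta>\<close>, \<open>1\<close>, \<open>tan \<theta>\<close>, \<open>- 1\<close>
  (\<open>principal_distribution_FKM\<close>, \<open>tilted_principal_curvatures\<close>).

  On \<open>T\<close> the compression \<open>W R\<^sub>x W\<close> equals \<open>- s W\<close>. It follows that
  \<open>(v, w) \<mapsto> v + R\<^sub>x v + w\<close> maps \<open>D\<^sub>1 \<oplus> D\<^sub>2\<close> isomorphically onto the \<open>+1\<close>-eigenspace of \<open>R\<^sub>x\<close> in \<open>T\<close>, which
  is the complement of \<open>x + R\<^sub>x x\<close> in the full \<open>+1\<close>-eigenspace of \<open>R\<^sub>x\<close>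
  (\<open>split_sum_in_fixed_space\<close>, \<open>split_parts_in_eigenspaces\<close>).
  Changing the signs of \<open>R\<^sub>x\<close> and \<open>s\<close> turns this into an isomorphism of \<open>D\<^sub>3 \<oplus> D\<^sub>4\<close> with the complement
  of \<open>x - R\<^sub>x x\<close> in the \<open>-1\<close>-eigenspace.

  So the two eigenspaces have to be identified, for all \<open>x\<close> at once, by a map that respects the two
  removed lines. This is where \<open>m\<close> odd enters: the sphere \<open>S\<^sup>m\<close> of unit coefficient vectors then has a
  nowhere vanishing tangent field, so a unit vector \<open>b\<close> orthogonal to \<open>a\<close> can be chosen depending
  linearly on \<open>a\<close>. The involution \<open>Q = \<Sum> b\<^sub>i P\<^sub>i\<close> anticommutes with \<open>R\<^sub>x\<close> and exchanges its eigenspaces.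
  It sends \<open>x + R\<^sub>x x\<close> to a vector orthogonal to \<open>x - R\<^sub>x x\<close>, hence after a canonical correction in the
  plane of these two vectors it identifies the complements (\<open>turn_fixed_space\<close>). Every map involved
  is polynomial in \<open>x\<close>, so the isomorphism and its inverse are smooth.
\<close>

section \<open>Smooth maps and bundle maps\<close>

definition smooth_map :: "('a::euclidean_space \<Rightarrow> 'b::euclidean_space) \<Rightarrow> bool" where
  "smooth_map f \<longleftrightarrow> (\<forall>k. Ck_on k f UNIV)"

lemma Ck_on_Suc_imp_Ck_on: "Ck_on (Suc k) f U \<Longrightarrow> Ck_on k f U"
proof (induction k arbitrary: f)
  case 0
  then show ?case
    by (auto intro!: continuous_at_imp_continuous_on differentiable_imp_continuous_within)
next
  case (Suc k)
  then show ?case by (metis Ck_on.simps(2))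
qed

lemma Ck_on_Suc_UNIV_I:
  assumes "\<And>x. (f has_derivative f' x) (at x)" "\<And>v. Ck_on k (\<lambda>x. f' x v) UNIV"
  shows "Ck_on (Suc k) f UNIV"
proof -
  have "frechet_derivative f (at x) = f' x" for x
    using frechet_derivative_at[OF assms(1)] by simp
  then show ?thesis using assms by (auto simp: differentiable_def)
qed

lemma Ck_on_Suc_UNIV_D:
  assumes "Ck_on (Suc k) f UNIV"
  obtains f' where "\<And>x. (f has_derivative f' x) (at x)" "\<And>v. Ck_on k (\<lambda>x. f' x v) UNIV"
  using that[of "\<lambda>x. frechet_derivative f (at x)"] assms by (auto simp: frechet_derivative_works)

lemma Ck_on_const: "Ck_on k (\<lambda>x. c) UNIV"
proof (induction k arbitrary: c)
  case (Suc k)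
  show ?case by (rule Ck_on_Suc_UNIV_I[where f' = "\<lambda>x v. 0"]) (auto intro: Suc)
qed simp

lemma Ck_on_add:
  "Ck_on k f UNIV \<Longrightarrow> Ck_on k g UNIV \<Longrightarrow> Ck_on k (\<lambda>x. f x + g x) UNIV"
proof (induction k arbitrary: f g)
  case 0
  then show ?case by (auto intro: continuous_intros)
next
  case (Suc k)
  obtain f' where f': "\<And>x. (f has_derivative f' x) (at x)" "\<And>v. Ck_on k (\<lambda>x. f' x v) UNIV"
    using Ck_on_Suc_UNIV_D[OF Suc.prems(1)] by blast
  obtain g' where g': "\<And>x. (g has_derivative g' x) (at x)" "\<And>v. Ck_on k (\<lambda>x. g' x v) UNIV"
    using Ck_on_Suc_UNIV_D[OF Suc.prems(2)] by blast
  show ?case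
    by (rule Ck_on_Suc_UNIV_I[where f' = "\<lambda>x v. f' x v + g' x v"])
      (auto intro!: Suc.IH f' g' derivative_intros)
qed

text \<open>The product rule expresses the derivative of \<open>b (f x) (g x)\<close> by two products of the same
  kind with one factor differentiated, so an induction on \<open>k\<close> goes through.\<close>

lemma Ck_on_bilinear:
  assumes b: "bounded_bilinear b"
  shows "Ck_on k f UNIV \<Longrightarrow> Ck_on k g UNIV \<Longrightarrow> Ck_on k (\<lambda>x. b (f x) (g x)) UNIV"
proof (induction k arbitrary: f g)
  case 0
  then show ?case using bounded_bilinear.continuous_on[OF b] by auto
next
  case (Suc k)
  obtain f' where f': "\<And>x. (f has_derivative f' x) (at x)" "\<And>v. Ck_on k (\<lambda>x. f' x v) UNIV"
    using Ck_on_Suc_UNIV_D[OF Suc.prems(1)] by blast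
  obtain g' where g': "\<And>x. (g has_derivative g' x) (at x)" "\<And>v. Ck_on k (\<lambda>x. g' x v) UNIV"
    using Ck_on_Suc_UNIV_D[OF Suc.prems(2)] by blast
  show ?case
    by (rule Ck_on_Suc_UNIV_I[where f' = "\<lambda>x v. b (f x) (g' x v) + b (f' x v) (g x)"])
      (auto intro!: Suc.IH f' g' bounded_bilinear.FDERIV[OF b] Ck_on_add
        Ck_on_Suc_imp_Ck_on[OF Suc.prems(1)] Ck_on_Suc_imp_Ck_on[OF Suc.prems(2)])
qed

lemma Ck_on_bounded_linear:
  assumes L: "bounded_linear L"
  shows "Ck_on k f UNIV \<Longrightarrow> Ck_on k (\<lambda>x. L (f x)) UNIV"
proof (induction k arbitrary: f)
  case 0
  then show ?case using bounded_linear.continuous_on[OF L] by auto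
next
  case (Suc k)
  obtain f' where f': "\<And>x. (f has_derivative f' x) (at x)" "\<And>v. Ck_on k (\<lambda>x. f' x v) UNIV"
    using Ck_on_Suc_UNIV_D[OF Suc.prems(1)] by blast
  show ?case
    by (rule Ck_on_Suc_UNIV_I[where f' = "\<lambda>x v. L (f' x v)"])
      (auto intro!: Suc.IH f' bounded_linear.has_derivative[OF L])
qed

lemma Ck_on_id: "Ck_on k (\<lambda>x. x) UNIV"
proof (cases k)
  case (Suc k)
  show ?thesis unfolding Suc
    by (rule Ck_on_Suc_UNIV_I[where f' = "\<lambda>x v. v"]) (auto intro: Ck_on_const)
qed auto

lemma smooth_map_const: "smooth_map (\<lambda>x. c)"
  by (simp add: smooth_map_def Ck_on_const)

lemma smooth_map_id: "smooth_map (\<lambda>x. x)"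
  by (simp add: smooth_map_def Ck_on_id)

lemma smooth_map_add: "smooth_map f \<Longrightarrow> smooth_map g \<Longrightarrow> smooth_map (\<lambda>x. f x + g x)"
  by (simp add: smooth_map_def Ck_on_add)

lemma smooth_map_bounded_linear: "bounded_linear L \<Longrightarrow> smooth_map f \<Longrightarrow> smooth_map (\<lambda>x. L (f x))"
  by (simp add: smooth_map_def Ck_on_bounded_linear)

lemma smooth_map_bilinear:
  "bounded_bilinear b \<Longrightarrow> smooth_map f \<Longrightarrow> smooth_map g \<Longrightarrow> smooth_map (\<lambda>x. b (f x) (g x))"
  by (simp add: smooth_map_def Ck_on_bilinear)

lemma smooth_map_sum:
  assumes "\<And>i. i \<in> I \<Longrightarrow> smooth_map (f i)"
  shows "smooth_map (\<lambda>x. \<Sum>i\<in>I. f i x)"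
  using assms
  by (induction I rule: infinite_finite_induct) (auto intro: smooth_map_const smooth_map_add)

lemma smooth_map_uminus: "smooth_map f \<Longrightarrow> smooth_map (\<lambda>x. - f x)"
  by (rule smooth_map_bounded_linear[OF bounded_linear_minus[OF bounded_linear_ident]])

lemma smooth_map_diff: "smooth_map f \<Longrightarrow> smooth_map g \<Longrightarrow> smooth_map (\<lambda>x. f x - g x)"
  using smooth_map_add[of f "\<lambda>x. - g x"] by (simp add: smooth_map_uminus)

lemma smooth_map_Pair:
  assumes "smooth_map f" "smooth_map g"
  shows "smooth_map (\<lambda>x. (f x, g x))"
proof -
  have "smooth_map (\<lambda>x. (f x, 0) + (0, g x))"
    by (intro smooth_map_add smooth_map_bounded_linear[OF _ assms(1)]
        smooth_map_bounded_linear[OF _ assms(2)] bounded_linear_Pair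
        bounded_linear_ident bounded_linear_zero)
  then show ?thesis by simp
qed

lemmas smooth_map_intros =
  smooth_map_const smooth_map_id smooth_map_add smooth_map_diff smooth_map_uminus smooth_map_Pair
  smooth_map_sum smooth_map_bounded_linear[OF bounded_linear_fst]
  smooth_map_bounded_linear[OF bounded_linear_snd]
  smooth_map_bilinear[OF bounded_bilinear_scaleR] smooth_map_bilinear[OF bounded_bilinear_inner]
  smooth_map_bilinear[OF bounded_bilinear_mult]
  smooth_map_bounded_linear[OF matrix_vector_mul_bounded_linear]

lemma smooth_map_imp_smooth_on:
  assumes "smooth_map h" "\<And>z. z \<in> A \<Longrightarrow> f z = h z"
  shows "smooth_on f A"
  unfolding smooth_on_def
proof (intro ballI)
  fix p assume "p \<in> A"
  show "\<exists>U h. open U \<and> p \<in> U \<and> (\<forall>k. Ck_on k h U) \<and> (\<forall>q\<in>A \<inter> U. h q = f q)"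
    by (rule exI[of _ UNIV], rule exI[of _ h]) (use assms in \<open>auto simp: smooth_map_def\<close>)
qed

text \<open>Mutually inverse families of fibre maps only have to be inverse on the fibres over \<open>M\<close>. Smoothness
  is then inherited from the ambient space, for the inverse too, because it agrees with \<open>G\<close> there.\<close>

lemma vector_bundle_isoI:
  fixes F G :: "'a::euclidean_space \<Rightarrow> 'b::euclidean_space \<Rightarrow> 'b"
  assumes F: "smooth_map (\<lambda>z. F (fst z) (snd z))" and G: "smooth_map (\<lambda>z. G (fst z) (snd z))"
    and lin: "\<And>x. x \<in> M \<Longrightarrow> linear (F x)"
    and FE: "\<And>x u. x \<in> M \<Longrightarrow> u \<in> E x \<Longrightarrow> F x u \<in> E' x \<and> G x (F x u) = u"
    and GE: "\<And>x u. x \<in> M \<Longrightarrow> u \<in> E' x \<Longrightarrow> G x u \<in> E x \<and> F x (G x u) = u"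
  shows "vector_bundle_iso M E E' (\<lambda>z. (fst z, F (fst z) (snd z)))"
proof -
  let ?\<Phi> = "\<lambda>z. (fst z, F (fst z) (snd z))"
  let ?\<Psi> = "\<lambda>z. (fst z, G (fst z) (snd z))"
  have bij: "bij_betw ?\<Phi> (Sigma M E) (Sigma M E')"
    by (rule bij_betw_byWitness[where f' = ?\<Psi>]) (use FE GE in auto)
  have inv: "inv_into (Sigma M E) ?\<Phi> z = ?\<Psi> z" if "z \<in> Sigma M E'" for z
  proof (rule inv_into_f_eq)
    show "inj_on ?\<Phi> (Sigma M E)" using bij by (simp add: bij_betw_def)
  qed (use that GE in auto)
  have "smooth_map ?\<Phi>" "smooth_map ?\<Psi>"
    by (intro smooth_map_intros F G)+
  then have "smooth_on ?\<Phi> (Sigma M E)" "smooth_on (inv_into (Sigma M E) ?\<Phi>) (Sigma M E')"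
    by (auto intro: smooth_map_imp_smooth_on simp: inv)
  then show ?thesis
    unfolding vector_bundle_iso_def using bij lin by (auto simp: linear_add linear_scale)
qed

section \<open>Tangent vectors and differentials\<close>

text \<open>Composing with a curve in \<open>S\<close> of velocity \<open>v\<close> turns either derivative into the derivative of the same
  function of one real variable.\<close>

lemma tangent_space_has_derivative_unique:
  assumes v: "v \<in> tangent_space S x"
    and "(h has_derivative h1) (at x within S)" "(h has_derivative h2) (at x within S)"
  shows "h1 v = h2 v"
proof -
  obtain e c where e: "e > 0" and c: "c ` {-e<..<e} \<subseteq> S" "c 0 = x"
      "(c has_vector_derivative v) (at 0)"
    using v unfolding tangent_space_def by blast
  have *: "((h \<circ> c) has_vector_derivative h' v) (at 0)"
    if "(h has_derivative h') (at x within S)" for h'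
  proof -
    have "(c has_derivative (\<lambda>t. t *\<^sub>R v)) (at 0 within {-e<..<e})"
      using c(3) by (simp add: has_vector_derivative_def has_derivative_at_withinI)
    moreover have "(h has_derivative h') (at (c 0) within c ` {-e<..<e})"
      using that c by (auto intro: has_derivative_subset)
    ultimately have "((h \<circ> c) has_derivative h' \<circ> (\<lambda>t. t *\<^sub>R v)) (at 0 within {-e<..<e})"
      by (rule diff_chain_within)
    moreover have "h' \<circ> (\<lambda>t. t *\<^sub>R v) = (\<lambda>t. t *\<^sub>R h' v)"
      using has_derivative_linear[OF that] by (auto simp: linear_scale)
    ultimately show ?thesis
      using e by (simp add: has_vector_derivative_def at_within_open[of 0 "{-e<..<e}"])
  qed
  show ?thesis
    using *[OF assms(2)] *[OF assms(3)] by (rule vector_derivative_unique_at)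
qed

lemma differential_on_eq:
  assumes "v \<in> tangent_space S x" "(h has_derivative h') (at x within S)"
  shows "differential_on S h x v = h' v"
  unfolding differential_on_def
  by (rule tangent_space_has_derivative_unique[OF assms(1) _ assms(2)])
    (use assms(2) in \<open>auto simp: frechet_derivative_works[symmetric] differentiable_def\<close>)

text \<open>On \<open>S\<close> the function \<open>h\<close> agrees with a constant, so \<open>0\<close> is a derivative of it within \<open>S\<close> as well.\<close>

lemma tangent_space_level_set:
  assumes v: "v \<in> tangent_space S x" and x: "x \<in> S" and h: "(h has_derivative h') (at x)"
    and const: "\<And>y. y \<in> S \<Longrightarrow> h y = (k :: 'b::euclidean_space)"
  shows "h' v = 0"
proof -
  have "((\<lambda>y. k) has_derivative (\<lambda>v. 0)) (at x within S)" by simp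
  then have "(h has_derivative (\<lambda>v. 0)) (at x within S)"
    by (rule has_derivative_transform[rotated 2]) (use x const in auto)
  then show ?thesis
    using tangent_space_has_derivative_unique[OF v has_derivative_at_withinI[OF h]] by blast
qed

lemma C1_onI:
  assumes "\<And>t. t \<in> S \<Longrightarrow> (f has_vector_derivative D t) (at t)" "continuous_on S D"
  shows "f C1_differentiable_on S"
  using assms unfolding C1_differentiable_on_def by blast

lemma C1_on_sqrt:
  fixes g :: "real \<Rightarrow> real"
  assumes "g C1_differentiable_on S" "\<And>t. t \<in> S \<Longrightarrow> g t > 0"
  shows "(\<lambda>t. sqrt (g t)) C1_differentiable_on S"
proof -
  obtain D where D: "\<And>t. t \<in> S \<Longrightarrow> (g has_vector_derivative D t) (at t)" "continuous_on S D"
    using assms(1) unfolding C1_differentiable_on_def by blast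
  have g: "continuous_on S g"
    using D(1) by (meson continuous_at_imp_continuous_on has_vector_derivative_continuous)
  have "((\<lambda>t. sqrt (g t)) has_vector_derivative D t / (2 * sqrt (g t))) (at t)" if "t \<in> S" for t
    using D(1)[OF that] assms(2)[OF that]
    by (auto simp flip: has_real_derivative_iff_has_vector_derivative
        intro!: derivative_eq_intros simp: field_simps)
  moreover have "continuous_on S (\<lambda>t. D t / (2 * sqrt (g t)))"
    using assms(2) by (intro continuous_intros D g) fastforce
  ultimately show ?thesis by (rule C1_onI)
qed

lemma C1_on_inverse:
  fixes g :: "real \<Rightarrow> real"
  assumes "g C1_differentiable_on S" "\<And>t. t \<in> S \<Longrightarrow> g t \<noteq> 0"
  shows "(\<lambda>t. inverse (g t)) C1_differentiable_on S"
proof -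
  obtain D where D: "\<And>t. t \<in> S \<Longrightarrow> (g has_vector_derivative D t) (at t)" "continuous_on S D"
    using assms(1) unfolding C1_differentiable_on_def by blast
  have g: "continuous_on S g"
    using D(1) by (meson continuous_at_imp_continuous_on has_vector_derivative_continuous)
  have "((\<lambda>t. inverse (g t)) has_vector_derivative - (D t / (g t * g t))) (at t)" if "t \<in> S" for t
    using D(1)[OF that] assms(2)[OF that]
    by (auto simp flip: has_real_derivative_iff_has_vector_derivative
        intro!: derivative_eq_intros simp: field_simps)
  moreover have "continuous_on S (\<lambda>t. - (D t / (g t * g t)))"
    using assms(2) by (intro continuous_intros D g) auto
  ultimately show ?thesis by (rule C1_onI)
qed

lemma C1_on_scaleR:
  fixes g :: "real \<Rightarrow> real" and f :: "real \<Rightarrow> 'a::euclidean_space"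
  assumes "g C1_differentiable_on S" "f C1_differentiable_on S"
  shows "(\<lambda>t. g t *\<^sub>R f t) C1_differentiable_on S"
proof -
  obtain D where D: "\<And>t. t \<in> S \<Longrightarrow> (g has_vector_derivative D t) (at t)" "continuous_on S D"
    using assms(1) unfolding C1_differentiable_on_def by blast
  obtain E where E: "\<And>t. t \<in> S \<Longrightarrow> (f has_vector_derivative E t) (at t)" "continuous_on S E"
    using assms(2) unfolding C1_differentiable_on_def by blast
  have "continuous_on S g" "continuous_on S f"
    using D(1) E(1) by (meson continuous_at_imp_continuous_on has_vector_derivative_continuous)+
  then have "continuous_on S (\<lambda>t. g t *\<^sub>R E t + D t *\<^sub>R f t)"
    by (intro continuous_intros D E)
  moreover have "((\<lambda>t. g t *\<^sub>R f t) has_vector_derivative g t *\<^sub>R E t + D t *\<^sub>R f t) (at t)"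
    if "t \<in> S" for t
    using D(1)[OF that] E(1)[OF that]
    by (auto simp flip: has_real_derivative_iff_has_vector_derivative
        intro!: has_vector_derivative_scaleR)
  ultimately show ?thesis by (intro C1_onI)
qed

lemma C1_on_bounded_linear:
  assumes "bounded_linear L" "f C1_differentiable_on S"
  shows "(\<lambda>t. L (f t)) C1_differentiable_on S"
proof -
  obtain E where E: "\<And>t. t \<in> S \<Longrightarrow> (f has_vector_derivative E t) (at t)" "continuous_on S E"
    using assms(2) unfolding C1_differentiable_on_def by blast
  then show ?thesis
    by (intro C1_onI[where D = "\<lambda>t. L (E t)"] bounded_linear.has_vector_derivative[OF assms(1)]
        bounded_linear.continuous_on[OF assms(1)])
qed

lemma C1_on_sum:
  fixes f :: "'i \<Rightarrow> real \<Rightarrow> 'a::real_normed_vector"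
  assumes "\<And>i. i \<in> I \<Longrightarrow> f i C1_differentiable_on S"
  shows "(\<lambda>t. \<Sum>i\<in>I. f i t) C1_differentiable_on S"
  using assms by (induction I rule: infinite_finite_induct) auto

lemma C1_on_inner:
  fixes f g :: "real \<Rightarrow> 'a::euclidean_space"
  assumes "g C1_differentiable_on S" "f C1_differentiable_on S"
  shows "(\<lambda>t. g t \<bullet> f t) C1_differentiable_on S"
proof -
  have "(\<lambda>t. \<Sum>i\<in>Basis. (g t \<bullet> i) *\<^sub>R (f t \<bullet> i)) C1_differentiable_on S"
    by (intro C1_on_sum
        C1_on_scaleR[OF C1_on_bounded_linear[OF bounded_linear_inner_left assms(1)]
          C1_on_bounded_linear[OF bounded_linear_inner_left assms(2)]])
  then show ?thesis by (subst euclidean_inner) simp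
qed

lemma tangent_space_sphere:
  fixes x :: "'a::euclidean_space"
  assumes "norm x = 1"
  shows "tangent_space (sphere 0 1) x = {v. v \<bullet> x = 0}"
proof (intro equalityI subsetI; clarify)
  fix v assume v: "v \<in> tangent_space (sphere 0 1) x"
  have "((\<lambda>y. y \<bullet> y) has_derivative (\<lambda>v. 2 * (v \<bullet> x))) (at x)"
    by (auto intro!: derivative_eq_intros simp: inner_commute)
  then have "2 * (v \<bullet> x) = 0"
    by (rule tangent_space_level_set[OF v, rotated]) (use assms in \<open>auto simp: dot_square_norm\<close>)
  then show "v \<bullet> x = 0" by simp
next
  fix v assume v: "v \<bullet> x = 0"
  \<comment> \<open>radial projection of the tangent line to the sphere; its scaling factor is stationary at \<open>0\<close>\<close>
  define g where "g t = inverse (sqrt (1 + t\<^sup>2 * (v \<bullet> v)))" for t :: real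
  define c where "c t = g t *\<^sub>R (x + t *\<^sub>R v)" for t
  have pos: "1 + t\<^sup>2 * (v \<bullet> v) > 0" for t by (simp add: add_pos_nonneg)
  have "g C1_differentiable_on S" for S
    unfolding g_def using pos
    by (intro C1_on_inverse C1_on_sqrt) (auto simp: power2_eq_square order_less_imp_not_eq2)
  then have C1: "c C1_differentiable_on S" for S
    unfolding c_def by (intro C1_on_scaleR) auto
  have "norm (x + t *\<^sub>R v) = sqrt (1 + t\<^sup>2 * (v \<bullet> v))" for t
    using v assms by (simp add: norm_eq_sqrt_inner inner_simps inner_commute[of x v] power2_eq_square)
  then have S: "c t \<in> sphere 0 1" for t
    using pos[of t] by (simp add: c_def g_def)
  have "(g has_real_derivative 0) (at 0)"
    unfolding g_def by (auto intro!: derivative_eq_intros)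
  then have "(c has_vector_derivative g 0 *\<^sub>R v + 0 *\<^sub>R (x + 0 *\<^sub>R v)) (at 0)"
    unfolding c_def
    by (intro has_vector_derivative_scaleR)
       (auto intro!: derivative_eq_intros simp: has_vector_derivative_def)
  then have "(c has_vector_derivative v) (at 0)" by (simp add: g_def)
  then show "v \<in> tangent_space (sphere 0 1) x"
    unfolding tangent_space_def mem_Collect_eq using C1 S
    by (intro exI[of _ 1] conjI exI[of _ c]) (auto simp: c_def g_def)
qed

section \<open>An involution compressed by a projection\<close>

definition split_sum :: "('a::real_vector \<Rightarrow> 'a) \<Rightarrow> 'a \<times> 'a \<Rightarrow> 'a" where
  "split_sum P w = fst w + P (fst w) + snd w"

text \<open>The inverse of \<open>split_sum\<close> on suitable eigenspaces. The factor is the one that recovers \<open>v\<close> of the form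
  \<open>\<mu> w + P w\<close> with \<open>W w = w\<close> from \<open>u = v + P v\<close>, since then \<open>W u = (1 - s) (\<mu> + 1) w\<close>.\<close>

definition split_parts ::
    "('a::real_vector \<Rightarrow> 'a) \<Rightarrow> ('a \<Rightarrow> 'a) \<Rightarrow> real \<Rightarrow> real \<Rightarrow> 'a \<Rightarrow> 'a \<times> 'a" where
  "split_parts P W s \<mu> u =
     (let v = (1 / ((1 - s) * (\<mu> + 1))) *\<^sub>R (\<mu> *\<^sub>R W u + P (W u)) in (v, u - v - P v))"

text \<open>The situation in a tangent space of the hypersurface, reduced to the algebra that it needs. The
  relations between \<open>P\<close>, \<open>W\<close> and \<open>s\<close> persist when \<open>P\<close> and \<open>s\<close> both change their sign, and \<open>eigenspace r\<close> below then becomes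
  \<open>eigenspace (- r)\<close>; one argument so treats both pairs of principal distributions.\<close>

locale compressed_involution =
  fixes T :: "'a::real_vector set" and P W :: "'a \<Rightarrow> 'a" and s :: real
  assumes T: "subspace T"
    and linP: "linear P" and linW: "linear W"
    and PT: "v \<in> T \<Longrightarrow> P v \<in> T" and PP: "v \<in> T \<Longrightarrow> P (P v) = v"
    and WT: "v \<in> T \<Longrightarrow> W v \<in> T" and WW: "v \<in> T \<Longrightarrow> W (W v) = W v"
    and WPW: "v \<in> T \<Longrightarrow> W (P (W v)) = - s *\<^sub>R W v"
    and s: "s \<noteq> 0" "s \<noteq> 1"
begin

definition eigenspace :: "real \<Rightarrow> 'a set" where
  "eigenspace r = {v \<in> T. P v + (2 / s) *\<^sub>R W v = r *\<^sub>R v}"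

lemmas lin_simps = linear_add[OF linP] linear_add[OF linW] linear_diff[OF linP] linear_diff[OF linW]
  linear_scale[OF linP] linear_scale[OF linW] linear_neg[OF linP] linear_neg[OF linW]

text \<open>Applying \<open>P\<close> to the eigenvalue equation gives \<open>P (W v) = - W v\<close>, and compressing this by \<open>W\<close> gives
  \<open>s W v = W v\<close>.\<close>

lemma eigenspace_1:
  assumes "v \<in> eigenspace 1"
  shows "v \<in> T" "W v = 0" "P v = v"
proof -
  show v: "v \<in> T" using assms by (simp add: eigenspace_def)
  have eq: "P v + (2 / s) *\<^sub>R W v = v" using assms by (simp add: eigenspace_def)
  have "v + (2 / s) *\<^sub>R P (W v) = P v"
    using arg_cong[OF eq, of P] v by (simp add: lin_simps PP)
  then have "v + ((2 / s) *\<^sub>R P (W v) + (2 / s) *\<^sub>R W v) = v"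
    using eq by (metis add.assoc)
  then have "(2 / s) *\<^sub>R (P (W v) + W v) = 0" by (simp add: scaleR_add_right)
  then have "P (W v) + W v = 0" using s by simp
  then have "W (P (W v)) + W (W v) = 0"
    using lin_simps(2) linear_0[OF linW] by metis
  then have "(1 - s) *\<^sub>R W v = 0"
    using v by (simp add: WW WPW algebra_simps)
  then show "W v = 0" using s by simp
  then show "P v = v" using eq by simp
qed

text \<open>Applying \<open>P\<close> to the eigenvalue equation and eliminating \<open>P v\<close> leaves
  \<open>(\<mu>\<^sup>2 - 1) v = (2/s) (\<mu> W v + P (W v))\<close>.\<close>

lemma eigenspace_normal_form:
  assumes "v \<in> eigenspace \<mu>" "\<mu>\<^sup>2 \<noteq> 1"
  obtains w where "w \<in> T" "W w = w" "v = \<mu> *\<^sub>R w + P w"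
proof -
  have v: "v \<in> T" and eq: "P v = \<mu> *\<^sub>R v - (2 / s) *\<^sub>R W v"
    using assms by (auto simp: eigenspace_def algebra_simps)
  have "v = \<mu> *\<^sub>R P v - (2 / s) *\<^sub>R P (W v)"
    using arg_cong[OF eq, of P] v by (simp add: lin_simps PP)
  then have "(\<mu>\<^sup>2 - 1) *\<^sub>R v = (2 / s) *\<^sub>R (\<mu> *\<^sub>R W v + P (W v))"
    by (simp add: eq algebra_simps power2_eq_square)
  then have "inverse (\<mu>\<^sup>2 - 1) *\<^sub>R ((\<mu>\<^sup>2 - 1) *\<^sub>R v)
      = inverse (\<mu>\<^sup>2 - 1) *\<^sub>R ((2 / s) *\<^sub>R (\<mu> *\<^sub>R W v + P (W v)))"
    by simp
  then have *: "v = (inverse (\<mu>\<^sup>2 - 1) * (2 / s)) *\<^sub>R (\<mu> *\<^sub>R W v + P (W v))"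
    using assms(2) by simp
  show ?thesis
  proof
    let ?w = "(inverse (\<mu>\<^sup>2 - 1) * (2 / s)) *\<^sub>R W v"
    show "?w \<in> T" using T v by (intro subspace_scale WT)
    show "W ?w = ?w" using v by (simp add: lin_simps WW)
    show "v = \<mu> *\<^sub>R ?w + P ?w"
      by (subst *) (simp add: lin_simps scaleR_add_right mult.commute)
  qed
qed

text \<open>The span of \<open>w\<close> and \<open>P w\<close>, where \<open>W w = w\<close>, is invariant under \<open>P + (2/s) W\<close>. The equation \<open>root\<close> is the
  characteristic equation on this plane.\<close>

context
  fixes \<mu> :: real
  assumes \<mu>: "\<mu>\<^sup>2 \<noteq> 1" and root: "s * (\<mu>\<^sup>2 + 1) = 2 * \<mu>"
begin

lemma \<mu>_neq: "\<mu> + 1 \<noteq> 0"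
  using \<mu> by (metis add_eq_0_iff2 power2_minus power_one)

lemma normal_form_in_eigenspace:
  assumes w: "w \<in> T" "W w = w"
  shows "\<mu> *\<^sub>R w + P w \<in> eigenspace \<mu>"
proof -
  have "W (P w) = - s *\<^sub>R w" using WPW[OF w(1)] w(2) by simp
  then have "W (\<mu> *\<^sub>R w + P w) = (\<mu> - s) *\<^sub>R w"
    using w by (simp add: lin_simps scaleR_diff_left)
  moreover have "P (\<mu> *\<^sub>R w + P w) = \<mu> *\<^sub>R P w + w"
    using w by (simp add: lin_simps PP)
  ultimately have "P (\<mu> *\<^sub>R w + P w) + (2 / s) *\<^sub>R W (\<mu> *\<^sub>R w + P w)
      = \<mu> *\<^sub>R P w + (1 + (2 / s) * (\<mu> - s)) *\<^sub>R w"
    by (simp only: scaleR_add_left scaleR_scaleR scaleR_one add.assoc)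
  also have "1 + (2 / s) * (\<mu> - s) = \<mu>\<^sup>2"
    using root s by (simp add: field_simps)
  finally show ?thesis
    using w T unfolding eigenspace_def
    by (auto simp: algebra_simps power2_eq_square intro!: subspace_add subspace_scale PT)
qed

lemma split_sum_in_fixed_space:
  assumes "w \<in> eigenspace \<mu> \<times> eigenspace 1"
  shows "split_sum P w \<in> {u \<in> T. P u = u} \<and> split_parts P W s \<mu> (split_sum P w) = w"
proof -
  obtain v1 v2 where w: "w = (v1, v2)" "v1 \<in> eigenspace \<mu>" "v2 \<in> eigenspace 1"
    using assms by auto
  note v2 = eigenspace_1[OF w(3)]
  obtain z where z: "z \<in> T" "W z = z" "v1 = \<mu> *\<^sub>R z + P z"
    using eigenspace_normal_form[OF w(2) \<mu>] by blast
  have WPz: "W (P z) = - s *\<^sub>R z" using WPW[OF z(1)] z(2) by simp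
  have u: "split_sum P w = (\<mu> + 1) *\<^sub>R (z + P z) + v2"
    using z by (simp add: split_sum_def w lin_simps PP algebra_simps)
  have "W (split_sum P w) = ((1 - s) * (\<mu> + 1)) *\<^sub>R z"
    unfolding u using z v2 WPz by (simp add: lin_simps algebra_simps)
  then have "(1 / ((1 - s) * (\<mu> + 1))) *\<^sub>R
      (\<mu> *\<^sub>R W (split_sum P w) + P (W (split_sum P w))) = v1"
    using s \<mu>_neq z by (simp add: lin_simps scaleR_add_right)
  then have "split_parts P W s \<mu> (split_sum P w) = (v1, split_sum P w - v1 - P v1)"
    by (simp add: split_parts_def)
  moreover have "split_sum P w - v1 - P v1 = v2" by (simp add: split_sum_def w)
  moreover have "P (split_sum P w) = split_sum P w"
    unfolding u using z v2 by (simp add: lin_simps PP algebra_simps)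
  moreover have "split_sum P w \<in> T"
    unfolding u using z v2 T by (intro subspace_add subspace_scale PT) auto
  ultimately show ?thesis using w by simp
qed

lemma split_parts_in_eigenspaces:
  assumes "u \<in> {u \<in> T. P u = u}"
  shows "split_parts P W s \<mu> u \<in> eigenspace \<mu> \<times> eigenspace 1 \<and>
    split_sum P (split_parts P W s \<mu> u) = u"
proof -
  have u: "u \<in> T" "P u = u" using assms by auto
  define k where "k = 1 / ((1 - s) * (\<mu> + 1))"
  define z where "z = k *\<^sub>R W u"
  define v where "v = \<mu> *\<^sub>R z + P z"
  have z: "z \<in> T" "W z = z"
    unfolding z_def using T u by (auto simp: lin_simps WW intro: subspace_scale WT)
  have WPz: "W (P z) = - s *\<^sub>R z" using WPW[OF z(1)] z(2) by simp
  have parts: "split_parts P W s \<mu> u = (v, u - v - P v)"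
    by (simp add: split_parts_def Let_def v_def z_def k_def lin_simps scaleR_add_right mult.commute)
  have vPv: "v + P v = (\<mu> + 1) *\<^sub>R (z + P z)"
    using z by (simp add: v_def lin_simps PP algebra_simps)
  have "W u = ((1 - s) * (\<mu> + 1)) *\<^sub>R z"
    using s \<mu>_neq by (simp add: z_def k_def)
  also have "\<dots> = W (v + P v)"
    unfolding vPv using z WPz by (simp add: lin_simps algebra_simps)
  finally have "W (u - v - P v) = 0" by (simp add: lin_simps)
  moreover have v: "v \<in> eigenspace \<mu>"
    unfolding v_def by (rule normal_form_in_eigenspace[OF z])
  then have "v \<in> T" by (simp add: eigenspace_def)
  moreover have "P (u - v - P v) = u - v - P v"
    using u \<open>v \<in> T\<close> by (simp add: lin_simps PP)
  moreover have "u - v - P v \<in> T"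
    using T u \<open>v \<in> T\<close> by (intro subspace_diff PT)
  ultimately have "u - v - P v \<in> eigenspace 1" by (simp add: eigenspace_def)
  then show ?thesis using v by (simp add: parts split_sum_def)
qed

end

end

section \<open>Exchanging the eigenspaces of an involution\<close>

text \<open>Let \<open>Q\<close> anticommute with \<open>P\<close> and put \<open>y = x - P x\<close>, \<open>z = x + P x\<close>. On the \<open>+1\<close>-eigenspace of \<open>P\<close> this
  map is \<open>Q\<close>, except that \<open>Q y\<close> is sent to \<open>Q z\<close> instead of \<open>y\<close>. The
  denominator is \<open>\<langle>y, y\<rangle>\<close> when \<open>x\<close> is a unit vector with \<open>\<langle>P x, x\<rangle> = s\<close>.\<close>

definition turn :: "('a::real_inner \<Rightarrow> 'a) \<Rightarrow> ('a \<Rightarrow> 'a) \<Rightarrow> real \<Rightarrow> 'a \<Rightarrow> 'a \<Rightarrow> 'a" where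
  "turn P Q s x u =
     Q u + ((u \<bullet> Q (x - P x)) / (2 * (1 - s))) *\<^sub>R (Q (x + P x) - (x - P x))"

text \<open>The vectors \<open>x - P x\<close> and \<open>Q (x + P x)\<close> are orthogonal, because \<open>\<langle>Q x, x\<rangle> = 0\<close>. So the
  exceptional direction \<open>Q (x - P x)\<close> lands in the complement of \<open>x - P x\<close>, and the coefficient of the
  correction can be read off from the image: it is the inner product with \<open>Q (x + P x)\<close>, up to the
  factor \<open>\<langle>x + P x, x + P x\<rangle> = 2 (1 + s)\<close>. The same recipe with the opposite signs therefore undoes it.\<close>

lemma turn_fixed_space:
  fixes P Q :: "'a::real_inner \<Rightarrow> 'a"
  assumes linP: "linear P" and linQ: "linear Q"
    and symP: "\<And>v w. P v \<bullet> w = v \<bullet> P w" and symQ: "\<And>v w. Q v \<bullet> w = v \<bullet> Q w"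
    and PP: "\<And>v. P (P v) = v" and QQ: "\<And>v. Q (Q v) = v"
    and anti: "\<And>v. P (Q v) = - Q (P v)"
    and x: "x \<bullet> x = 1" "P x \<bullet> x = s" "Q x \<bullet> x = 0" and s: "s \<noteq> 1" "s \<noteq> - 1"
    and u: "P u = u" "u \<bullet> x = 0"
  shows "P (turn P Q s x u) = - turn P Q s x u" (is ?fix)
    and "turn P Q s x u \<bullet> x = 0" (is ?orth)
    and "turn (\<lambda>v. - P v) Q (- s) x (turn P Q s x u) = u" (is ?inv)
proof -
  note lin = linear_add[OF linP] linear_add[OF linQ] linear_diff[OF linP] linear_diff[OF linQ]
    linear_scale[OF linP] linear_scale[OF linQ] linear_neg[OF linP] linear_neg[OF linQ]
  define k where "k = (u \<bullet> Q (x - P x)) / (2 * (1 - s))"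
  define w where "w = turn P Q s x u"
  have w: "w = Q u + k *\<^sub>R (Q (x + P x) - (x - P x))"
    by (simp add: w_def turn_def k_def)
  show ?fix
    unfolding w_def[symmetric] unfolding w using u
    by (simp add: lin anti PP algebra_simps)
  have PxQx: "P x \<bullet> Q x = 0"
  proof -
    have "P x \<bullet> Q x = x \<bullet> P (Q x)" by (simp add: symP)
    also have "\<dots> = - (Q x \<bullet> P x)" by (simp add: anti symQ)
    finally show ?thesis by (simp add: inner_commute)
  qed
  have PxQPx: "P x \<bullet> Q (P x) = 0"
  proof -
    have "P x \<bullet> Q (P x) = - (P x \<bullet> P (Q x))" by (simp add: anti)
    also have "\<dots> = - (x \<bullet> Q x)" by (simp add: symP PP)
    finally show ?thesis using x by (simp add: inner_commute)
  qed
  have xQPx: "x \<bullet> Q (P x) = 0" using PxQx symQ[of x "P x"] by (simp add: inner_commute)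
  have uPx: "u \<bullet> P x = 0" using u by (metis symP)
  have uQPx: "u \<bullet> Q (P x) = - (u \<bullet> Q x)"
    using anti[of x] symP[of u "Q x"] u by (metis inner_minus_right minus_minus)
  have uy: "u \<bullet> Q (x - P x) = 2 * (u \<bullet> Q x)"
    by (simp add: lin inner_diff_right uQPx)
  have k: "k * (1 - s) = u \<bullet> Q x"
    using s by (simp add: k_def uy field_simps)
  have "w \<bullet> x = u \<bullet> Q x - k * (1 - s)"
    using x PxQx by (simp add: w lin inner_simps symQ inner_commute[of "Q _"] xQPx algebra_simps)
  then show ?orth unfolding w_def[symmetric] using k by simp
  have PxPx: "P x \<bullet> P x = 1" using x by (simp add: symP PP)
  have "w \<bullet> Q (x + P x) = Q u \<bullet> Q (x + P x) + k * (Q (x + P x) \<bullet> Q (x + P x) - (x - P x) \<bullet> Q (x + P x))"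
    by (simp add: w inner_simps algebra_simps)
  also have "Q u \<bullet> Q (x + P x) = 0"
    using u uPx by (simp add: symQ QQ inner_simps)
  also have "Q (x + P x) \<bullet> Q (x + P x) = 2 * (1 + s)"
    using x PxPx by (simp add: symQ QQ inner_simps inner_commute)
  also have "(x - P x) \<bullet> Q (x + P x) = 0"
    using x PxQx PxQPx xQPx by (simp add: lin inner_simps inner_commute)
  finally have "(w \<bullet> Q (x + P x)) / (2 * (1 + s)) = k"
    using s by (simp add: field_simps)
  then have "turn (\<lambda>v. - P v) Q (- s) x w = Q w + k *\<^sub>R (Q (x - P x) - (x + P x))"
    by (simp add: turn_def)
  also have "\<dots> = u" by (simp add: w lin QQ algebra_simps)
  finally show ?inv by (simp add: w_def)
qed

section \<open>Clifford systems\<close>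

definition clifford_op :: "nat \<Rightarrow> (nat \<Rightarrow> real^'n^'n) \<Rightarrow> (nat \<Rightarrow> real) \<Rightarrow> real^'n \<Rightarrow> real^'n" where
  "clifford_op m P a v = (\<Sum>i\<le>m. a i *\<^sub>R (P i *v v))"

definition coeff_inner :: "nat \<Rightarrow> (nat \<Rightarrow> real) \<Rightarrow> (nat \<Rightarrow> real) \<Rightarrow> real" where
  "coeff_inner m a b = (\<Sum>i\<le>m. a i * b i)"

text \<open>The coordinates of the moment map \<open>x \<mapsto> (\<langle>P\<^sub>i x, x\<rangle>)\<^sub>i\<close>; the hypersurface is
  a level set of the length of this vector in the sphere.\<close>

definition moment :: "(nat \<Rightarrow> real^'n^'n) \<Rightarrow> real^'n \<Rightarrow> nat \<Rightarrow> real" where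
  "moment P x i = (P i *v x) \<bullet> x"

text \<open>For a unit vector \<open>x\<close> the vectors \<open>P\<^sub>i x\<close> are orthonormal, and this is the orthogonal projection onto
  their span. Without a normalization it is polynomial in \<open>x\<close>.\<close>

definition span_proj :: "nat \<Rightarrow> (nat \<Rightarrow> real^'n^'n) \<Rightarrow> real^'n \<Rightarrow> real^'n \<Rightarrow> real^'n" where
  "span_proj m P x v = clifford_op m P (\<lambda>i. (P i *v x) \<bullet> v) x"

text \<open>The scale \<open>s\<close> is a parameter instead of the length of the moment vector: it is constant on
  the hypersurface, this keeps the operator polynomial in \<open>x\<close>, and \<open>- s\<close> gives the opposite involution.\<close>

definition point_involution :: "nat \<Rightarrow> (nat \<Rightarrow> real^'n^'n) \<Rightarrow> real \<Rightarrow> real^'n \<Rightarrow> real^'n \<Rightarrow> real^'n" where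
  "point_involution m P s x v = (1 / s) *\<^sub>R clifford_op m P (moment P x) v"

lemma coeff_inner_commute: "coeff_inner m a b = coeff_inner m b a"
  by (simp add: coeff_inner_def mult.commute)

lemma linear_clifford_op: "linear (clifford_op m P a)"
  unfolding clifford_op_def
  by (intro linear_compose_sum ballI linear_compose_scale_right matrix_vector_mul_linear)

lemma clifford_op_scale: "clifford_op m P (\<lambda>i. k * a i) v = k *\<^sub>R clifford_op m P a v"
  by (simp add: clifford_op_def scaleR_sum_right)

lemma clifford_op_add: "clifford_op m P (\<lambda>i. a i + b i) v = clifford_op m P a v + clifford_op m P b v"
  by (simp add: clifford_op_def sum.distrib scaleR_add_left)

lemma linear_point_involution: "linear (point_involution m P s x)"
  unfolding point_involution_def by (intro linear_compose_scale_right linear_clifford_op)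

lemma linear_span_proj: "linear (span_proj m P x)"
  unfolding span_proj_def
  by (rule linearI) (simp_all add: inner_add_right clifford_op_add clifford_op_scale)

lemma clifford_op_inner: "clifford_op m P b x \<bullet> v = (\<Sum>i\<le>m. b i * ((P i *v x) \<bullet> v))"
  by (simp add: clifford_op_def inner_sum_left)

lemma clifford_op_inner_self: "clifford_op m P b x \<bullet> x = coeff_inner m b (moment P x)"
  by (simp add: clifford_op_inner coeff_inner_def moment_def)

lemma has_derivative_moment:
  assumes "\<And>v w. (P i *v v) \<bullet> w = v \<bullet> (P i *v w)"
  shows "((\<lambda>y. moment P y i) has_derivative (\<lambda>v. 2 * ((P i *v x) \<bullet> v))) (at x within S)"
proof -
  have "((\<lambda>y. (P i *v y) \<bullet> y) has_derivative (\<lambda>v. (P i *v x) \<bullet> v + (P i *v v) \<bullet> x)) (at x within S)"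
    by (auto intro!: derivative_eq_intros bounded_linear_imp_has_derivative
        matrix_vector_mul_bounded_linear)
  moreover have "(P i *v v) \<bullet> x = (P i *v x) \<bullet> v" for v
    by (metis assms inner_commute)
  ultimately show ?thesis by (simp add: moment_def)
qed

locale clifford =
  fixes m :: nat and P :: "nat \<Rightarrow> real^'n^'n"
  assumes system: "clifford_system m P"
begin

abbreviation "cl \<equiv> clifford_op m P"
abbreviation "dt \<equiv> coeff_inner m"
abbreviation "proj \<equiv> span_proj m P"
abbreviation "R \<equiv> point_involution m P"

lemma P_sym: "i \<le> m \<Longrightarrow> (P i *v v) \<bullet> w = v \<bullet> (P i *v w)"
  using system unfolding clifford_system_def
  by (metis dot_lmul_matrix transpose_matrix_vector)

lemma P_anti:
  assumes "i \<le> m" "j \<le> m"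
  shows "P i *v (P j *v v) + P j *v (P i *v v) = (if i = j then 2 else 0) *\<^sub>R v"
proof -
  have "P i ** P j + P j ** P i = (if i = j then 2 else 0) *\<^sub>R mat 1"
    using system assms unfolding clifford_system_def by blast
  then have "(P i ** P j + P j ** P i) *v v = ((if i = j then 2 else 0) *\<^sub>R mat 1) *v v" by simp
  then show ?thesis
    by (simp add: matrix_vector_mult_add_rdistrib matrix_vector_mul_assoc
        scaleR_matrix_vector_assoc[symmetric] split: if_splits)
qed

lemma cl_sym: "cl a v \<bullet> w = v \<bullet> cl a w"
  by (simp add: clifford_op_def inner_sum_left inner_sum_right P_sym)

lemma cl_anti: "cl a (cl b v) + cl b (cl a v) = (2 * dt a b) *\<^sub>R v"
proof -
  have expand: "cl a (cl b v) = (\<Sum>i\<le>m. \<Sum>j\<le>m. (a i * b j) *\<^sub>R (P i *v (P j *v v)))" for a b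
    unfolding clifford_op_def
    by (simp add: scaleR_sum_right linear_sum[OF matrix_vector_mul_linear]
        linear_scale[OF matrix_vector_mul_linear])
  have "cl b (cl a v) = (\<Sum>i\<le>m. \<Sum>j\<le>m. (b j * a i) *\<^sub>R (P j *v (P i *v v)))"
    unfolding expand by (rule sum.swap)
  then have "cl a (cl b v) + cl b (cl a v)
      = (\<Sum>i\<le>m. \<Sum>j\<le>m. (a i * b j) *\<^sub>R (P i *v (P j *v v) + P j *v (P i *v v)))"
    by (simp add: expand sum.distrib scaleR_add_right mult.commute)
  also have "\<dots> = (\<Sum>i\<le>m. \<Sum>j\<le>m. if j = i then (2 * (a i * b i)) *\<^sub>R v else 0)"
    by (intro sum.cong refl) (auto simp: P_anti)
  also have "\<dots> = (2 * dt a b) *\<^sub>R v"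
    by (simp add: coeff_inner_def scaleR_sum_left sum_distrib_left)
  finally show ?thesis .
qed

lemma cl_square: "cl a (cl a v) = dt a a *\<^sub>R v"
proof -
  have "2 *\<^sub>R cl a (cl a v) = 2 *\<^sub>R (dt a a *\<^sub>R v)"
    using cl_anti[of a a v] by (simp add: scaleR_2[symmetric])
  then show ?thesis by (rule scaleR_left_imp_eq[rotated]) simp
qed

lemma cl_inner_cl: "cl a v \<bullet> cl b v = dt a b * (v \<bullet> v)"
proof -
  have "2 * (cl a v \<bullet> cl b v) = v \<bullet> cl a (cl b v) + cl b (cl a v) \<bullet> v"
    by (simp add: cl_sym)
  also have "\<dots> = v \<bullet> (cl a (cl b v) + cl b (cl a v))"
    by (simp add: inner_add_right inner_commute)
  also have "\<dots> = 2 * (dt a b * (v \<bullet> v))" by (simp add: cl_anti)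
  finally show ?thesis by simp
qed

lemma cl_single:
  assumes "i \<le> m"
  shows "cl (\<lambda>j. if j = i then 1 else 0) v = P i *v v"
    and "dt (\<lambda>j. if j = i then 1 else 0) b = b i"
  using assms
  by (simp_all add: clifford_op_def coeff_inner_def if_distrib[of "\<lambda>c. c *\<^sub>R _"]
      if_distrib[of "\<lambda>c. c * _"] cong: if_cong)

lemma P_inner_cl: "i \<le> m \<Longrightarrow> (P i *v v) \<bullet> cl b v = b i * (v \<bullet> v)"
  using cl_inner_cl[of "\<lambda>j. if j = i then 1 else 0" v b] by (simp add: cl_single)

lemma P_cl_anti: "i \<le> m \<Longrightarrow> P i *v (cl b v) + cl b (P i *v v) = (2 * b i) *\<^sub>R v"
  using cl_anti[of "\<lambda>j. if j = i then 1 else 0" b v] by (simp add: cl_single)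

lemma coeff_cong: "(\<And>i. i \<le> m \<Longrightarrow> a i = b i) \<Longrightarrow> cl a v = cl b v"
  by (simp add: clifford_op_def)

end

section \<open>The tangent space at a point of the hypersurface\<close>

text \<open>The sign of \<open>s\<close> is left open, so that the results apply to the opposite involution too.\<close>

locale FKM_point = clifford m P for m :: nat and P :: "nat \<Rightarrow> real^'n^'n" +
  fixes s :: real and x :: "real^'n"
  assumes norm_x: "x \<bullet> x = 1" and moment_x: "coeff_inner m (moment P x) (moment P x) = s\<^sup>2"
    and s_nz: "s \<noteq> 0" and s_bound: "\<bar>s\<bar> < 1"
begin

text \<open>The orthogonal complement of the two normal directions \<open>x\<close> and \<open>R x\<close>; \<open>tangent_space_FKM_level\<close>
  identifies it with the tangent space.\<close>

definition T :: "(real^'n) set" where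
  "T = {v. v \<bullet> x = 0 \<and> v \<bullet> R s x x = 0}"

lemma R_sym: "R s x v \<bullet> w = v \<bullet> R s x w"
  by (simp add: point_involution_def cl_sym)

lemma R_R: "R s x (R s x v) = v"
  using s_nz
  by (simp add: point_involution_def linear_scale[OF linear_clifford_op] cl_square moment_x
      power2_eq_square)

lemma R_x: "R s x x \<bullet> x = s"
  using s_nz by (simp add: point_involution_def clifford_op_inner_self moment_x power2_eq_square)

lemma T_orth:
  assumes "v \<in> T"
  shows "dt (moment P x) (\<lambda>i. (P i *v x) \<bullet> v) = 0"
  using assms s_nz unfolding T_def point_involution_def
  by (simp add: inner_commute[of v] clifford_op_inner coeff_inner_def)

lemma proj_T:
  assumes "v \<in> T"
  shows "proj x v \<in> T"
proof -
  have "proj x v \<bullet> x = 0"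
    unfolding span_proj_def clifford_op_inner_self using T_orth[OF assms]
    by (simp add: coeff_inner_commute)
  moreover have "proj x v \<bullet> cl (moment P x) x = 0"
    unfolding span_proj_def cl_inner_cl using T_orth[OF assms] by (simp add: coeff_inner_commute)
  ultimately show ?thesis by (simp add: T_def point_involution_def)
qed

lemma proj_proj: "proj x (proj x v) = proj x v"
  unfolding span_proj_def by (rule coeff_cong) (simp add: P_inner_cl norm_x)

text \<open>Let \<open>w = \<Sum> b\<^sub>i P\<^sub>i x\<close> be the projection of \<open>v\<close> and \<open>a\<close> the moment vector. As \<open>v\<close> is tangent, \<open>a\<close> and \<open>b\<close> are
  orthogonal, so their Clifford operators anticommute. Moving \<open>P\<^sub>i\<close> past both of them expresses the
  coefficient \<open>\<langle>P\<^sub>i x, R w\<rangle>\<close> by its own negative and \<open>- 2 s b\<^sub>i\<close>.\<close>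

lemma proj_R_proj:
  assumes "v \<in> T"
  shows "proj x (R s x (proj x v)) = - s *\<^sub>R proj x v"
proof -
  define b where "b i = (P i *v x) \<bullet> v" for i
  define w where "w = cl b x"
  define a where "a = moment P x"
  have ab: "dt a b = 0" using T_orth[OF assms] by (simp add: a_def b_def[abs_def])
  have w: "proj x v = w" by (simp add: span_proj_def b_def[abs_def] w_def)
  have "(P i *v x) \<bullet> R s x w = - s * b i" if i: "i \<le> m" for i
  proof -
    have anti: "cl a w = - cl b (cl a x)" unfolding w_def
      using cl_anti[of a b x] ab by (simp add: eq_neg_iff_add_eq_0)
    have "(P i *v x) \<bullet> cl a w = (cl a (P i *v x)) \<bullet> w" by (simp add: cl_sym)
    also have "cl a (P i *v x) = (2 * a i) *\<^sub>R x - P i *v (cl a x)"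
      using P_cl_anti[OF i, of a x] by (simp add: algebra_simps)
    also have "\<dots> \<bullet> w = - ((P i *v (cl a x)) \<bullet> w)"
      using ab by (simp add: inner_diff_left w_def inner_commute[of x] clifford_op_inner_self
          coeff_inner_commute a_def)
    also have "(P i *v (cl a x)) \<bullet> w = cl a x \<bullet> (P i *v (cl b x))"
      by (simp add: P_sym[OF i] w_def)
    also have "P i *v (cl b x) = (2 * b i) *\<^sub>R x - cl b (P i *v x)"
      using P_cl_anti[OF i, of b x] by (simp add: algebra_simps)
    also have "cl a x \<bullet> \<dots> = 2 * b i * s\<^sup>2 - cl b (cl a x) \<bullet> (P i *v x)"
      by (simp add: inner_diff_right clifford_op_inner_self moment_x a_def cl_sym)
    also have "cl b (cl a x) = - cl a w" by (simp add: anti)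
    finally have "(P i *v x) \<bullet> cl a w = - (b i * s\<^sup>2)"
      by (simp add: inner_commute)
    then show ?thesis using s_nz
      by (simp add: point_involution_def a_def[symmetric] power2_eq_square)
  qed
  then have "proj x (R s x w) = cl (\<lambda>i. - s * b i) x"
    unfolding span_proj_def by (intro coeff_cong) simp
  then show ?thesis by (simp only: w clifford_op_scale w_def)
qed

lemma R_T: "v \<in> T \<Longrightarrow> R s x v \<in> T"
  by (simp add: T_def R_sym R_R)

sublocale leaf: compressed_involution T "R s x" "proj x" s
proof (rule compressed_involution.intro)
  show "subspace T" by (auto simp: T_def subspace_def inner_simps)
qed (use s_nz s_bound linear_point_involution linear_span_proj R_T R_R proj_T proj_proj proj_R_proj in auto)

lemma turn_in_opposite_space:
  assumes b: "dt b b = 1" "dt b (moment P x) = 0" and u: "u \<in> {u \<in> T. R s x u = u}"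
  shows "turn (R s x) (cl b) s x u \<in> {u \<in> T. - R s x u = u} \<and>
    turn (\<lambda>v. - R s x v) (cl b) (- s) x (turn (R s x) (cl b) s x u) = u"
proof -
  have anti: "R s x (cl b v) = - cl b (R s x v)" for v
    using cl_anti[of b "moment P x" v] b
    by (simp add: point_involution_def linear_scale[OF linear_clifford_op] eq_neg_iff_add_eq_0
        scaleR_add_right[symmetric] add.commute)
  have ux: "R s x u = u" "u \<bullet> x = 0" using u by (auto simp: T_def)
  have bb: "cl b (cl b v) = v" for v using b by (simp add: cl_square)
  have bx: "cl b x \<bullet> x = 0" using b by (simp add: clifford_op_inner_self)
  have "s \<noteq> 1" "s \<noteq> -1" using s_bound by auto
  note * = turn_fixed_space[OF linear_point_involution linear_clifford_op R_sym cl_sym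
      R_R bb anti norm_x R_x bx this ux]
  have "turn (R s x) (cl b) s x u \<bullet> R s x x = R s x (turn (R s x) (cl b) s x u) \<bullet> x"
    by (simp add: R_sym)
  then show ?thesis using * by (simp add: T_def)
qed

end

section \<open>Level sets and their tangent spaces\<close>

context clifford
begin

definition FKM_level :: "real \<Rightarrow> (real^'n) set" where
  "FKM_level s = {y. y \<bullet> y = 1 \<and> dt (moment P y) (moment P y) = s\<^sup>2}"

text \<open>The plane spanned by \<open>y\<close> and \<open>Z\<close> is invariant under the involution attached to \<open>y\<close>; moving inside it
  only rescales the moment vector.\<close>

lemma moment_linear_combination:
  fixes y :: "real^'n"
  defines "Z \<equiv> cl (moment P y) y"
  assumes "i \<le> m"
  shows "moment P (A *\<^sub>R y + B *\<^sub>R Z) i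
    = moment P y i * (A\<^sup>2 + 2 * A * B * (y \<bullet> y) + B\<^sup>2 * dt (moment P y) (moment P y))"
proof -
  let ?a = "moment P y"
  have yZ: "(P i *v y) \<bullet> Z = ?a i * (y \<bullet> y)" unfolding Z_def by (rule P_inner_cl[OF assms(2)])
  have Zy: "(P i *v Z) \<bullet> y = ?a i * (y \<bullet> y)"
    using yZ by (metis P_sym[OF assms(2)] inner_commute)
  have "P i *v Z = (2 * ?a i) *\<^sub>R y - cl ?a (P i *v y)"
    using P_cl_anti[OF assms(2), of ?a y] by (simp add: Z_def algebra_simps)
  then have "(P i *v Z) \<bullet> Z = 2 * ?a i * (y \<bullet> Z) - (P i *v y) \<bullet> cl ?a Z"
    by (simp add: inner_diff_left cl_sym)
  also have "y \<bullet> Z = dt ?a ?a" by (simp add: Z_def inner_commute[of y] clifford_op_inner_self)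
  also have "cl ?a Z = dt ?a ?a *\<^sub>R y" by (simp add: Z_def cl_square)
  also have "(P i *v y) \<bullet> (dt ?a ?a *\<^sub>R y) = dt ?a ?a * ?a i" by (simp add: moment_def)
  finally have ZZ: "(P i *v Z) \<bullet> Z = ?a i * dt ?a ?a" by simp
  have "moment P (A *\<^sub>R y + B *\<^sub>R Z) i
      = A\<^sup>2 * ((P i *v y) \<bullet> y) + A * B * ((P i *v y) \<bullet> Z) + A * B * ((P i *v Z) \<bullet> y) + B\<^sup>2 * ((P i *v Z) \<bullet> Z)"
    unfolding moment_def
    by (simp add: matrix_vector_right_distrib linear_scale[OF matrix_vector_mul_linear]
        inner_add_left inner_add_right algebra_simps power2_eq_square)
  also have "(P i *v y) \<bullet> y = ?a i" by (simp add: moment_def)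
  finally show ?thesis unfolding yZ Zy ZZ by (simp add: algebra_simps)
qed

text \<open>A retraction of a neighbourhood onto the level set. Split \<open>y\<close> into its components in the two
  eigenspaces of the involution attached to \<open>y\<close>, whose squared lengths are \<open>(\<langle>y, y\<rangle> \<plusminus> r) / 2\<close>, and
  rescale these by \<open>\<alpha>\<close> and \<open>\<beta>\<close> to the squared lengths \<open>(1 \<plusminus> s) / 2\<close> that they have on the level set.\<close>

lemma rescaled_point_in_level:
  fixes y :: "real^'n"
  defines "Z \<equiv> cl (moment P y) y" and "q \<equiv> dt (moment P y) (moment P y)"
  assumes r: "r > 0" "r\<^sup>2 = q"
    and \<alpha>: "\<alpha>\<^sup>2 * (y \<bullet> y + r) = 1 + s" and \<beta>: "\<beta>\<^sup>2 * (y \<bullet> y - r) = 1 - s"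
  shows "((\<alpha> + \<beta>) / 2) *\<^sub>R y + ((\<alpha> - \<beta>) / (2 * r)) *\<^sub>R Z \<in> FKM_level s"
proof -
  define A B where "A = (\<alpha> + \<beta>) / 2" and "B = (\<alpha> - \<beta>) / (2 * r)"
  have Br: "B * r = (\<alpha> - \<beta>) / 2" using r by (simp add: B_def)
  define c where "c = A *\<^sub>R y + B *\<^sub>R Z"
  have "Z \<bullet> y = q" "Z \<bullet> Z = q * (y \<bullet> y)"
    by (simp_all add: Z_def q_def clifford_op_inner_self cl_inner_cl)
  then have "c \<bullet> c = A\<^sup>2 * (y \<bullet> y) + 2 * A * (B * r) * r + (B * r)\<^sup>2 * (y \<bullet> y)"
    by (simp add: c_def inner_simps inner_commute[of y Z] r(2)[symmetric] algebra_simps power2_eq_square)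
  also have "\<dots> = (\<alpha>\<^sup>2 * (y \<bullet> y + r) + \<beta>\<^sup>2 * (y \<bullet> y - r)) / 2"
    unfolding Br by (simp add: A_def field_simps power2_eq_square)
  finally have cc: "c \<bullet> c = 1" using \<alpha> \<beta> by simp
  have "r * (A\<^sup>2 + 2 * A * B * (y \<bullet> y) + B\<^sup>2 * q) = r * A\<^sup>2 + 2 * A * (B * r) * (y \<bullet> y) + r * (B * r)\<^sup>2"
    by (simp add: r(2)[symmetric] algebra_simps power2_eq_square)
  also have "\<dots> = (\<alpha>\<^sup>2 * (y \<bullet> y + r) - \<beta>\<^sup>2 * (y \<bullet> y - r)) / 2"
    unfolding Br by (simp add: A_def field_simps power2_eq_square)
  finally have E: "r * (A\<^sup>2 + 2 * A * B * (y \<bullet> y) + B\<^sup>2 * q) = s" using \<alpha> \<beta> by simp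
  have scaled: "dt (\<lambda>i. a i * k) (\<lambda>i. a i * k) = k\<^sup>2 * dt a a" for a k
    by (simp add: coeff_inner_def sum_distrib_left power2_eq_square mult_ac)
  have "moment P c i = moment P y i * (A\<^sup>2 + 2 * A * B * (y \<bullet> y) + B\<^sup>2 * q)" if "i \<le> m" for i
    unfolding c_def Z_def q_def by (rule moment_linear_combination[OF that])
  then have "dt (moment P c) (moment P c) = (A\<^sup>2 + 2 * A * B * (y \<bullet> y) + B\<^sup>2 * q)\<^sup>2 * q"
    using scaled[of "moment P y"] by (simp add: coeff_inner_def q_def)
  also have "\<dots> = (r * (A\<^sup>2 + 2 * A * B * (y \<bullet> y) + B\<^sup>2 * q))\<^sup>2"
    by (simp only: r(2)[symmetric] power_mult_distrib mult.commute)
  finally have "dt (moment P c) (moment P c) = s\<^sup>2" by (simp only: E)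
  then show ?thesis using cc by (simp add: FKM_level_def c_def A_def B_def)
qed

end

context FKM_point
begin

lemma x_in_level: "x \<in> FKM_level s"
  by (simp add: FKM_level_def norm_x moment_x)

lemma has_derivative_coeff_inner_moment:
  "((\<lambda>y. dt (moment P y) (moment P y)) has_derivative (\<lambda>v. 4 * s * (R s x x \<bullet> v))) (at x)"
proof -
  have "((\<lambda>y. \<Sum>i\<le>m. moment P y i * moment P y i) has_derivative
      (\<lambda>v. \<Sum>i\<le>m. moment P x i * (2 * ((P i *v x) \<bullet> v)) + 2 * ((P i *v x) \<bullet> v) * moment P x i)) (at x)"
    by (intro has_derivative_sum has_derivative_mult has_derivative_moment P_sym) auto
  moreover have "(\<Sum>i\<le>m. moment P x i * (2 * ((P i *v x) \<bullet> v)) + 2 * ((P i *v x) \<bullet> v) * moment P x i)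
      = 4 * s * (R s x x \<bullet> v)" for v
    using s_nz by (simp add: point_involution_def clifford_op_inner sum_distrib_left algebra_simps)
  ultimately show ?thesis by (simp add: coeff_inner_def)
qed

lemma tangent_space_level_subset: "tangent_space (FKM_level s) x \<subseteq> T"
proof
  fix v assume v: "v \<in> tangent_space (FKM_level s) x"
  have "((\<lambda>y. y \<bullet> y) has_derivative (\<lambda>v. 2 * (v \<bullet> x))) (at x)"
    by (auto intro!: derivative_eq_intros simp: inner_commute)
  then have "2 * (v \<bullet> x) = 0"
    by (rule tangent_space_level_set[OF v x_in_level]) (simp add: FKM_level_def)
  moreover have "4 * s * (R s x x \<bullet> v) = 0"
    by (rule tangent_space_level_set[OF v x_in_level has_derivative_coeff_inner_moment])
      (simp add: FKM_level_def)
  ultimately show "v \<in> T" using s_nz by (simp add: T_def inner_commute)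
qed

text \<open>The curve is the retraction of the line \<open>x + t v\<close>. The norm and the length of the moment vector are
  stationary in the direction \<open>v\<close>, hence so are the scaling factors \<open>\<alpha>\<close> and \<open>\<beta>\<close>; both are \<open>1\<close> at \<open>x\<close>,
  so the retraction does not change the velocity \<open>v\<close>.\<close>

lemma T_subset_tangent_space:
  assumes s: "s > 0"
  shows "T \<subseteq> tangent_space (FKM_level s) x"
proof
  fix v assume v: "v \<in> T"
  define y where "y t = x + t *\<^sub>R v" for t :: real
  define n where "n t = y t \<bullet> y t" for t
  define q where "q t = dt (moment P (y t)) (moment P (y t))" for t
  define r where "r t = sqrt (q t)" for t
  define Z where "Z t = cl (moment P (y t)) (y t)" for t
  define \<alpha> where "\<alpha> t = sqrt ((1 + s) * inverse (n t + r t))" for t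
  define \<beta> where "\<beta> t = sqrt ((1 - s) * inverse (n t - r t))" for t
  define c where "c t = ((\<alpha> t + \<beta> t) / 2) *\<^sub>R y t + ((\<alpha> t - \<beta> t) / (2 * r t)) *\<^sub>R Z t" for t
  define U where "U = {t. q t > 0 \<and> n t - r t > 0}"
  have y1: "y C1_differentiable_on S" for S unfolding y_def by (intro C1_differentiable_on_add) auto
  have Py: "(\<lambda>t. P i *v y t) C1_differentiable_on S" for i S
    by (rule C1_on_bounded_linear[OF matrix_vector_mul_bounded_linear y1])
  have m1: "(\<lambda>t. moment P (y t) i) C1_differentiable_on S" for i S
    unfolding moment_def by (intro C1_on_inner Py y1)
  have n1: "n C1_differentiable_on S" for S unfolding n_def by (intro C1_on_inner y1)
  have q1: "q C1_differentiable_on S" for S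
    unfolding q_def coeff_inner_def by (intro C1_on_sum C1_differentiable_on_mult m1)
  have Z1: "Z C1_differentiable_on S" for S
    unfolding Z_def clifford_op_def by (intro C1_on_sum C1_on_scaleR m1 Py)
  have C1_cont: "continuous_on S g" if "g C1_differentiable_on S" for S and g :: "real \<Rightarrow> real"
    using that unfolding C1_differentiable_on_def
    by (meson continuous_at_imp_continuous_on has_vector_derivative_continuous)
  have cont: "continuous_on UNIV q" "continuous_on UNIV (\<lambda>t. n t - r t)"
    unfolding r_def by (intro continuous_intros C1_cont q1 n1)+
  have "open U"
    unfolding U_def
    by (intro open_Collect_conj open_Collect_less cont continuous_on_const)
  moreover have zero: "y 0 = x" "n 0 = 1" "q 0 = s\<^sup>2" "r 0 = s" "\<alpha> 0 = 1" "\<beta> 0 = 1"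
    using s s_bound by (simp_all add: y_def n_def q_def r_def \<alpha>_def \<beta>_def norm_x moment_x)
  then have "0 \<in> U" using s s_bound by (simp add: U_def)
  ultimately obtain e where e: "e > 0" "{-e<..<e} \<subseteq> U"
    by (force simp: open_dist dist_real_def subset_eq abs_less_iff)
  have U: "q t > 0" "r t > 0" "n t - r t > 0" "n t + r t > 0" if "t \<in> U" for t
  proof -
    show "q t > 0" "n t - r t > 0" using that by (auto simp: U_def)
    moreover from this show "r t > 0" by (simp add: r_def)
    ultimately show "n t + r t > 0" by linarith
  qed
  have r1: "r C1_differentiable_on U"
    unfolding r_def using U by (intro C1_on_sqrt q1) auto
  have nr: "n t + r t \<noteq> 0" "n t - r t \<noteq> 0" "2 * r t \<noteq> 0" if "t \<in> U" for t
    using U[OF that] by auto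
  have "\<alpha> C1_differentiable_on U"
    unfolding \<alpha>_def using U s s_bound nr
    by (intro C1_on_sqrt C1_differentiable_on_mult C1_differentiable_on_const C1_on_inverse
        C1_differentiable_on_add n1 r1) auto
  moreover have "\<beta> C1_differentiable_on U"
    unfolding \<beta>_def using U s s_bound nr
    by (intro C1_on_sqrt C1_differentiable_on_mult C1_differentiable_on_const C1_on_inverse
        C1_differentiable_on_diff n1 r1) auto
  ultimately have c1: "c C1_differentiable_on U"
    unfolding c_def divide_inverse using nr
    by (intro C1_differentiable_on_add C1_on_scaleR C1_differentiable_on_mult
        C1_differentiable_on_diff C1_differentiable_on_const C1_on_inverse y1 Z1 r1)
  have level: "c t \<in> FKM_level s" if "t \<in> U" for t
  proof -
    have "((\<alpha> t + \<beta> t) / 2) *\<^sub>R y t + ((\<alpha> t - \<beta> t) / (2 * r t)) *\<^sub>R cl (moment P (y t)) (y t)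
        \<in> FKM_level s"
    proof (rule rescaled_point_in_level)
      show "r t > 0" using U that by blast
      show "(r t)\<^sup>2 = dt (moment P (y t)) (moment P (y t))"
        using U(1)[OF that] by (simp add: r_def q_def)
      show "(\<alpha> t)\<^sup>2 * (y t \<bullet> y t + r t) = 1 + s" "(\<beta> t)\<^sup>2 * (y t \<bullet> y t - r t) = 1 - s"
        using U[OF that] s s_bound nr[OF that] by (auto simp: \<alpha>_def \<beta>_def n_def[symmetric])
    qed
    then show ?thesis by (simp add: c_def Z_def)
  qed
  have y': "(y has_vector_derivative v) (at t)" for t
    unfolding y_def by (auto intro!: derivative_eq_intros simp: has_vector_derivative_def)
  have chain: "((\<lambda>t. g (y t)) has_real_derivative g' v) (at 0)"
    if g: "(g has_derivative g') (at x)" for g :: "real^'n \<Rightarrow> real" and g'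
  proof -
    have "(y has_derivative (\<lambda>t. t *\<^sub>R v)) (at 0)"
      using y'[of 0] by (simp add: has_vector_derivative_def)
    then have "((\<lambda>t. g (y t)) has_derivative (\<lambda>t. g' (t *\<^sub>R v))) (at 0)"
      by (rule has_derivative_compose) (simp add: zero g)
    then show ?thesis
      by (simp add: has_field_derivative_def linear_scale[OF has_derivative_linear[OF g]] mult_commute_abs)
  qed
  have "((\<lambda>y. y \<bullet> y) has_derivative (\<lambda>v. 2 * (v \<bullet> x))) (at x)"
    by (auto intro!: derivative_eq_intros simp: inner_commute)
  then have n': "(n has_real_derivative 0) (at 0)"
    using chain v unfolding n_def by (fastforce simp: T_def)
  have q': "(q has_real_derivative 0) (at 0)"
    using chain[OF has_derivative_coeff_inner_moment] v unfolding q_def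
    by (simp add: T_def inner_commute)
  have r': "(r has_real_derivative 0) (at 0)"
    unfolding r_def using q' s zero by (auto intro!: derivative_eq_intros)
  have \<alpha>': "(\<alpha> has_real_derivative 0) (at 0)"
    unfolding \<alpha>_def using n' r' s zero by (auto intro!: derivative_eq_intros)
  have \<beta>': "(\<beta> has_real_derivative 0) (at 0)"
    unfolding \<beta>_def using n' r' s s_bound zero by (auto intro!: derivative_eq_intros)
  have "((\<lambda>t. (\<alpha> t + \<beta> t) / 2) has_real_derivative 0) (at 0)"
    by (auto intro!: derivative_eq_intros \<alpha>' \<beta>')
  moreover have "((\<lambda>t. (\<alpha> t - \<beta> t) / (2 * r t)) has_real_derivative 0) (at 0)"
    using s by (auto intro!: derivative_eq_intros \<alpha>' \<beta>' r' simp: zero)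
  moreover obtain Z' where "(Z has_vector_derivative Z') (at 0)"
    using Z1[of UNIV] unfolding C1_differentiable_on_def by blast
  ultimately have "(c has_vector_derivative
      (((\<alpha> 0 + \<beta> 0) / 2) *\<^sub>R v + 0 *\<^sub>R y 0)
      + (((\<alpha> 0 - \<beta> 0) / (2 * r 0)) *\<^sub>R Z' + 0 *\<^sub>R Z 0)) (at 0)"
    unfolding c_def by (intro has_vector_derivative_add has_vector_derivative_scaleR y')
  then have "(c has_vector_derivative v) (at 0)" by (simp add: zero)
  moreover have "c 0 = x" by (simp add: c_def zero)
  moreover have "c C1_differentiable_on {-e<..<e}"
    using c1 e by (meson C1_differentiable_on_subset)
  ultimately show "v \<in> tangent_space (FKM_level s) x"
    unfolding tangent_space_def using e level by blast
qed

lemma tangent_space_FKM_level: "s > 0 \<Longrightarrow> tangent_space (FKM_level s) x = T"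
  using tangent_space_level_subset T_subset_tangent_space by blast

end

section \<open>Unit normal and principal distributions\<close>

lemma (in clifford) FKM_poly_eq:
  "FKM_poly m P y = (y \<bullet> y)\<^sup>2 - 2 * dt (moment P y) (moment P y)"
proof -
  have "norm y ^ 4 = ((norm y)\<^sup>2)\<^sup>2" by (simp flip: power_mult)
  also have "\<dots> = (y \<bullet> y)\<^sup>2" by (simp only: power2_norm_eq_inner)
  finally show ?thesis
    by (simp add: FKM_poly_def coeff_inner_def moment_def power2_eq_square)
qed

lemma (in clifford) FKM_hypersurface_eq: "FKM_hypersurface m P \<theta> = FKM_level (sin (2 * \<theta>))"
proof -
  have "cos (4 * \<theta>) = 1 - 2 * (sin (2 * \<theta>))\<^sup>2"
    using cos_double_sin[of "2 * \<theta>"] by simp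
  then show ?thesis
    by (auto simp: FKM_hypersurface_def FKM_level_def FKM_poly_eq norm_eq_1)
qed

context FKM_point
begin

lemma gradient_FKM: "gradient_on (sphere 0 1) (FKM_poly m P) x = (8 * s) *\<^sub>R (s *\<^sub>R x - R s x x)"
proof -
  have tan: "tangent_space (sphere 0 1) x = {v. v \<bullet> x = 0}"
    using norm_x by (intro tangent_space_sphere) (simp add: norm_eq_1)
  have "((\<lambda>y. (y \<bullet> y) * (y \<bullet> y) - 2 * dt (moment P y) (moment P y)) has_derivative
      (\<lambda>v. ((x \<bullet> x) * (x \<bullet> v + v \<bullet> x) + (x \<bullet> v + v \<bullet> x) * (x \<bullet> x)) - 2 * (4 * s * (R s x x \<bullet> v)))) (at x)"
    by (intro has_derivative_diff has_derivative_mult_right has_derivative_coeff_inner_moment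
        has_derivative_mult has_derivative_inner has_derivative_ident)
  moreover have "((x \<bullet> x) * (x \<bullet> v + v \<bullet> x) + (x \<bullet> v + v \<bullet> x) * (x \<bullet> x)) - 2 * (4 * s * (R s x x \<bullet> v))
      = 4 * (v \<bullet> x) - 8 * s * (R s x x \<bullet> v)" for v
    using inner_commute[of v x] norm_x by simp
  ultimately have "(FKM_poly m P has_derivative (\<lambda>v. 4 * (v \<bullet> x) - 8 * s * (R s x x \<bullet> v)))
      (at x within sphere 0 1)"
    unfolding FKM_poly_eq[abs_def] power2_eq_square
    by (simp add: has_derivative_at_withinI mult.assoc)
  then have diff: "differential_on (sphere 0 1) (FKM_poly m P) x v = ((8 * s) *\<^sub>R (s *\<^sub>R x - R s x x)) \<bullet> v"
    if "v \<bullet> x = 0" for v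
  proof -
    have "differential_on (sphere 0 1) (FKM_poly m P) x v = 4 * (v \<bullet> x) - 8 * s * (R s x x \<bullet> v)"
      by (rule differential_on_eq) (use that tan \<open>(FKM_poly m P has_derivative _) _\<close> in auto)
    then show ?thesis using that inner_commute[of v x] by (simp add: inner_diff_left)
  qed
  have g: "((8 * s) *\<^sub>R (s *\<^sub>R x - R s x x)) \<bullet> x = 0"
    by (simp add: inner_diff_left norm_x R_x)
  show ?thesis unfolding gradient_on_def tan
  proof (rule the_equality)
    show "(8 * s) *\<^sub>R (s *\<^sub>R x - R s x x) \<in> {v. v \<bullet> x = 0} \<and>
      (\<forall>v\<in>{v. v \<bullet> x = 0}. differential_on (sphere 0 1) (FKM_poly m P) x v =
        ((8 * s) *\<^sub>R (s *\<^sub>R x - R s x x)) \<bullet> v)"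
      using diff g by blast
  next
    fix k assume k: "k \<in> {v. v \<bullet> x = 0} \<and>
      (\<forall>v\<in>{v. v \<bullet> x = 0}. differential_on (sphere 0 1) (FKM_poly m P) x v = k \<bullet> v)"
    \<comment> \<open>a second candidate differs from the gradient by a tangent vector that is orthogonal to itself\<close>
    let ?d = "k - (8 * s) *\<^sub>R (s *\<^sub>R x - R s x x)"
    have d: "?d \<bullet> x = 0" using k g by (simp only: inner_diff_left) simp
    then have "k \<bullet> ?d = ((8 * s) *\<^sub>R (s *\<^sub>R x - R s x x)) \<bullet> ?d"
      using k diff[OF d] by simp
    then have "?d \<bullet> ?d = 0" by (simp only: inner_diff_left)
    then show "k = (8 * s) *\<^sub>R (s *\<^sub>R x - R s x x)" by simp
  qed
qed

lemma unit_normal_FKM: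
  assumes "s > 0"
  shows "unit_normal m P x = (1 / sqrt (1 - s\<^sup>2)) *\<^sub>R (s *\<^sub>R x - R s x x)"
proof -
  have "R s x x \<bullet> R s x x = 1" by (simp add: R_sym R_R norm_x)
  then have "norm (s *\<^sub>R x - R s x x) = sqrt (1 - s\<^sup>2)"
    using R_x by (simp add: norm_eq_sqrt_inner inner_simps norm_x inner_commute power2_eq_square algebra_simps)
  then show ?thesis
    using assms by (simp add: unit_normal_def gradient_FKM Let_def)
qed

end

lemma (in clifford) FKM_pointI:
  "x \<in> FKM_level s \<Longrightarrow> s \<noteq> 0 \<Longrightarrow> \<bar>s\<bar> < 1 \<Longrightarrow> FKM_point m P s x"
  by unfold_locales (auto simp: FKM_level_def)

context FKM_point
begin

text \<open>On the level set the unit normal coincides with one polynomial map, which can be differentiated in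
  the ambient space. The derivative of the moments contributes the projection term.\<close>

lemma shape_operator_FKM:
  assumes s: "s > 0" "s = sin (2 * \<theta>)" and v: "v \<in> T"
  shows "shape_operator m P \<theta> x v
    = (1 / sqrt (1 - s\<^sup>2)) *\<^sub>R (R s x v + (2 / s) *\<^sub>R proj x v - s *\<^sub>R v)"
proof -
  let ?N = "\<lambda>y. (1 / sqrt (1 - s\<^sup>2)) *\<^sub>R (s *\<^sub>R y - (1 / s) *\<^sub>R (\<Sum>i\<le>m. moment P y i *\<^sub>R (P i *v y)))"
  let ?N' = "\<lambda>v. (1 / sqrt (1 - s\<^sup>2)) *\<^sub>R (s *\<^sub>R v - (1 / s) *\<^sub>R
      (\<Sum>i\<le>m. moment P x i *\<^sub>R (P i *v v) + (2 * ((P i *v x) \<bullet> v)) *\<^sub>R (P i *v x)))"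
  have "(?N has_derivative ?N') (at x within FKM_level s)"
    by (intro has_derivative_scaleR_right has_derivative_diff has_derivative_ident has_derivative_sum
        has_derivative_scaleR has_derivative_moment P_sym bounded_linear_imp_has_derivative
        matrix_vector_mul_bounded_linear) auto
  moreover have "unit_normal m P y = ?N y" if "y \<in> FKM_level s" for y
  proof -
    interpret y: FKM_point m P s y
      using that s_nz s_bound by (rule FKM_pointI)
    show ?thesis
      by (simp add: y.unit_normal_FKM[OF s(1)] point_involution_def clifford_op_def)
  qed
  ultimately have "(unit_normal m P has_derivative ?N') (at x within FKM_level s)"
    using x_in_level by (intro has_derivative_transform[of x _ "unit_normal m P" ?N]) auto
  then have "shape_operator m P \<theta> x v = - ?N' v"
    unfolding shape_operator_def FKM_hypersurface_eq s(2)[symmetric]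
    using v tangent_space_FKM_level[OF s(1)] by (subst differential_on_eq) auto
  also have "(\<Sum>i\<le>m. moment P x i *\<^sub>R (P i *v v) + (2 * ((P i *v x) \<bullet> v)) *\<^sub>R (P i *v x))
      = cl (moment P x) v + 2 *\<^sub>R proj x v"
    by (simp add: sum.distrib clifford_op_def span_proj_def scaleR_sum_right)
  finally show ?thesis
    by (simp add: point_involution_def scaleR_add_right scaleR_diff_right)
qed

lemma principal_distribution_FKM:
  assumes s: "s > 0" "s = sin (2 * \<theta>)"
  shows "principal_distribution m P \<theta> k x
    = leaf.eigenspace (s + sqrt (1 - s\<^sup>2) * principal_curvature \<theta> k)"
proof -
  have scaled_eq: "(1 / c) *\<^sub>R (w - s *\<^sub>R v) = l *\<^sub>R v \<longleftrightarrow> w = (s + c * l) *\<^sub>R v"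
    if c: "c > 0" for w v :: "real^'n" and c l :: real
  proof
    assume eq: "(1 / c) *\<^sub>R (w - s *\<^sub>R v) = l *\<^sub>R v"
    have "w - s *\<^sub>R v = c *\<^sub>R ((1 / c) *\<^sub>R (w - s *\<^sub>R v))" using c by simp
    also have "\<dots> = (c * l) *\<^sub>R v" unfolding eq by simp
    finally show "w = (s + c * l) *\<^sub>R v" by (simp add: scaleR_add_left diff_eq_eq add.commute)
  next
    assume "w = (s + c * l) *\<^sub>R v"
    then have "w - s *\<^sub>R v = c *\<^sub>R (l *\<^sub>R v)" by (simp add: scaleR_add_left)
    then show "(1 / c) *\<^sub>R (w - s *\<^sub>R v) = l *\<^sub>R v" using c by simp
  qed
  have "sqrt (1 - s\<^sup>2) > 0" using s_bound by (simp add: abs_square_less_1)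
  from scaled_eq[OF this] show ?thesis
    unfolding principal_distribution_def leaf.eigenspace_def FKM_hypersurface_eq s(2)[symmetric]
      tangent_space_FKM_level[OF s(1)]
    using shape_operator_FKM[OF s] by auto
qed

end

section \<open>The bundle isomorphism\<close>

text \<open>The standard tangent field of an odd-dimensional sphere: for odd \<open>m\<close> the indices \<open>0, \<dots>, m\<close> fall into
  pairs \<open>(2j, 2j + 1)\<close>, and each pair of coordinates is rotated by a quarter turn.\<close>

definition pair_rotation :: "(nat \<Rightarrow> real) \<Rightarrow> nat \<Rightarrow> real" where
  "pair_rotation a i = (if even i then - a (i + 1) else a (i - 1))"

lemma coeff_inner_pair_rotation:
  assumes "odd m"
  shows "coeff_inner m (pair_rotation a) (pair_rotation a) = coeff_inner m a a"
    and "coeff_inner m (pair_rotation a) a = 0"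
proof -
  obtain n where m: "m = 2 * n + 1" using assms by (elim oddE)
  have "coeff_inner (2 * n + 1) (pair_rotation a) (pair_rotation a) = coeff_inner (2 * n + 1) a a
      \<and> coeff_inner (2 * n + 1) (pair_rotation a) a = 0"
    by (induction n) (simp_all add: coeff_inner_def pair_rotation_def)
  then show "coeff_inner m (pair_rotation a) (pair_rotation a) = coeff_inner m a a"
    and "coeff_inner m (pair_rotation a) a = 0" by (simp_all add: m)
qed

text \<open>With \<open>s = sin 2\<theta>\<close> and \<open>\<nu> = - tan \<theta>\<close> this maps \<open>D\<^sub>1 \<oplus> D\<^sub>2\<close> to the \<open>+1\<close>-eigenspace of the involution
  in the tangent space, then to the \<open>-1\<close>-eigenspace, then to \<open>D\<^sub>3 \<oplus> D\<^sub>4\<close>. With \<open>- s\<close> and \<open>cot \<theta>\<close> it goes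
  the other way; the absolute value keeps the operator in the middle step the same for both signs.\<close>

definition fibre_map ::
    "nat \<Rightarrow> (nat \<Rightarrow> real^'n^'n) \<Rightarrow> real \<Rightarrow> real \<Rightarrow> real^'n \<Rightarrow> (real^'n) \<times> (real^'n)
      \<Rightarrow> (real^'n) \<times> (real^'n)" where
  "fibre_map m P s \<nu> x w =
     split_parts (point_involution m P (- s) x) (span_proj m P x) (- s) \<nu>
       (turn (point_involution m P s x)
         (clifford_op m P (\<lambda>i. pair_rotation (moment P x) i / \<bar>s\<bar>)) s x
         (split_sum (point_involution m P s x) w))"

lemma linear_fibre_map: "linear (fibre_map m P s \<nu> x)"
proof (rule linearI)
  note lin = linear_add[OF linear_point_involution] linear_scale[OF linear_point_involution]
    linear_add[OF linear_span_proj] linear_scale[OF linear_span_proj]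
    linear_add[OF linear_clifford_op] linear_scale[OF linear_clifford_op]
  have sum: "split_sum (point_involution m P s x) (v + w)
      = split_sum (point_involution m P s x) v + split_sum (point_involution m P s x) w"
    "split_sum (point_involution m P s x) (r *\<^sub>R v) = r *\<^sub>R split_sum (point_involution m P s x) v"
    for v w r
    by (simp_all add: split_sum_def lin scaleR_add_right)
  have turn: "turn (point_involution m P s x) (clifford_op m P b) s x (v + w)
      = turn (point_involution m P s x) (clifford_op m P b) s x v
        + turn (point_involution m P s x) (clifford_op m P b) s x w"
    "turn (point_involution m P s x) (clifford_op m P b) s x (r *\<^sub>R v)
      = r *\<^sub>R turn (point_involution m P s x) (clifford_op m P b) s x v" for v w r b
    by (simp_all add: turn_def lin inner_add_left add_divide_distrib scaleR_add_left scaleR_add_right)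
  have parts: "split_parts (point_involution m P (- s) x) (span_proj m P x) (- s) \<nu> (v + w)
      = split_parts (point_involution m P (- s) x) (span_proj m P x) (- s) \<nu> v
        + split_parts (point_involution m P (- s) x) (span_proj m P x) (- s) \<nu> w"
    "split_parts (point_involution m P (- s) x) (span_proj m P x) (- s) \<nu> (r *\<^sub>R v)
      = r *\<^sub>R split_parts (point_involution m P (- s) x) (span_proj m P x) (- s) \<nu> v" for v w r
    by (simp_all add: split_parts_def Let_def lin scaleR_add_right scaleR_diff_right mult.commute)
  show "fibre_map m P s \<nu> x (v + w) = fibre_map m P s \<nu> x v + fibre_map m P s \<nu> x w" for v w
    by (simp only: fibre_map_def sum turn parts)
  show "fibre_map m P s \<nu> x (r *\<^sub>R v) = r *\<^sub>R fibre_map m P s \<nu> x v" for v r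
    by (simp only: fibre_map_def sum turn parts)
qed

lemma smooth_map_divide_const: "smooth_map f \<Longrightarrow> smooth_map (\<lambda>z. f z / (c :: real))"
  unfolding divide_inverse by (intro smooth_map_intros)

lemma smooth_map_clifford_op:
  assumes "\<And>i. smooth_map (\<lambda>z. a z i)" "smooth_map v"
  shows "smooth_map (\<lambda>z. clifford_op m P (a z) (v z))"
  unfolding clifford_op_def by (intro smooth_map_intros assms)

lemma smooth_map_moment: "smooth_map y \<Longrightarrow> smooth_map (\<lambda>z. moment P (y z) i)"
  unfolding moment_def by (intro smooth_map_intros)

lemma smooth_map_fibre_map:
  fixes P :: "nat \<Rightarrow> real^'n^'n"
  shows "smooth_map (\<lambda>z. fibre_map m P s \<nu> (fst z) (snd z))"
proof -
  have PI: "smooth_map (\<lambda>z. point_involution m P r (y z) (v z))"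
    if "smooth_map y" "smooth_map v" for r and y v :: "'c::euclidean_space \<Rightarrow> real^'n"
    unfolding point_involution_def
    by (intro smooth_map_intros smooth_map_clifford_op smooth_map_moment that)
  have proj: "smooth_map (\<lambda>z. span_proj m P (y z) (v z))"
    if "smooth_map y" "smooth_map v" for y v :: "'c::euclidean_space \<Rightarrow> real^'n"
    unfolding span_proj_def by (intro smooth_map_intros smooth_map_clifford_op that)
  have rot: "smooth_map (\<lambda>z. clifford_op m P (\<lambda>i. pair_rotation (moment P (y z)) i / \<bar>s\<bar>) (v z))"
    if "smooth_map y" "smooth_map v" for y v :: "'c::euclidean_space \<Rightarrow> real^'n"
  proof (intro smooth_map_clifford_op smooth_map_divide_const that)
    show "smooth_map (\<lambda>z. pair_rotation (moment P (y z)) i)" for i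
      using smooth_map_moment[OF that(1)] by (cases "even i") (auto simp: pair_rotation_def intro: smooth_map_uminus)
  qed
  show ?thesis
    unfolding fibre_map_def split_parts_def turn_def split_sum_def Let_def
    by (intro smooth_map_intros smooth_map_divide_const PI proj rot)
qed

context FKM_point
begin

lemma opposite: "FKM_point m P (- s) x"
  by unfold_locales (use norm_x moment_x s_nz s_bound in auto)

lemma point_involution_minus: "R (- s) x = (\<lambda>v. - R s x v)"
  by (simp add: point_involution_def fun_eq_iff)

lemma opposite_T: "FKM_point.T m P (- s) x = T"
  using FKM_point.T_def[OF opposite] by (simp add: T_def point_involution_minus)

lemma opposite_eigenspace:
  "compressed_involution.eigenspace (FKM_point.T m P (- s) x) (R (- s) x) (proj x) (- s) r
    = leaf.eigenspace (- r)"
proof -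
  interpret N: FKM_point m P "- s" x by (rule opposite)
  have "- a - b = r *\<^sub>R v \<longleftrightarrow> a + b = - (r *\<^sub>R v)" for a b v :: "real^'n"
  proof -
    have "- a - b = - (a + b)" by simp
    then show ?thesis by (metis minus_minus)
  qed
  then show ?thesis
    unfolding N.leaf.eigenspace_def leaf.eigenspace_def unfolding opposite_T
    by (simp add: point_involution_minus)
qed

lemma fibre_map_eigenspaces:
  assumes m: "odd m"
    and \<mu>: "\<mu>\<^sup>2 \<noteq> 1" "s * (\<mu>\<^sup>2 + 1) = 2 * \<mu>" and \<nu>: "\<nu>\<^sup>2 \<noteq> 1" "- s * (\<nu>\<^sup>2 + 1) = 2 * \<nu>"
    and w: "w \<in> leaf.eigenspace \<mu> \<times> leaf.eigenspace 1"
  shows "fibre_map m P s \<nu> x w \<in> leaf.eigenspace (- \<nu>) \<times> leaf.eigenspace (- 1)"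
    and "fibre_map m P (- s) \<mu> x (fibre_map m P s \<nu> x w) = w"
proof -
  interpret N: FKM_point m P "- s" x by (rule opposite)
  define b where "b = (\<lambda>i. pair_rotation (moment P x) i / \<bar>s\<bar>)"
  have b: "dt b b = 1" "dt b (moment P x) = 0"
  proof -
    have "dt b b = dt (pair_rotation (moment P x)) (pair_rotation (moment P x)) / s\<^sup>2"
      by (simp add: coeff_inner_def b_def sum_divide_distrib power2_eq_square)
    then show "dt b b = 1" using s_nz by (simp add: coeff_inner_pair_rotation[OF m] moment_x)
    have "dt b (moment P x) = dt (pair_rotation (moment P x)) (moment P x) / \<bar>s\<bar>"
      by (simp add: coeff_inner_def b_def sum_divide_distrib)
    then show "dt b (moment P x) = 0" by (simp add: coeff_inner_pair_rotation[OF m])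
  qed
  define u where "u = split_sum (R s x) w"
  define t where "t = turn (R s x) (cl b) s x u"
  have f: "fibre_map m P s \<nu> x w = split_parts (R (- s) x) (proj x) (- s) \<nu> t"
    by (simp add: fibre_map_def t_def u_def b_def)
  have u: "u \<in> {u \<in> T. R s x u = u}" "split_parts (R s x) (proj x) s \<mu> u = w"
    using leaf.split_sum_in_fixed_space[OF \<mu> w] by (auto simp: u_def)
  have t: "t \<in> {u \<in> N.T. R (- s) x u = u}" "turn (R (- s) x) (cl b) (- s) x t = u"
    using turn_in_opposite_space[OF b u(1)] by (simp_all add: t_def opposite_T point_involution_minus)
  note parts = N.leaf.split_parts_in_eigenspaces[OF \<nu> t(1)]
  then show "fibre_map m P s \<nu> x w \<in> leaf.eigenspace (- \<nu>) \<times> leaf.eigenspace (- 1)"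
    by (simp add: f opposite_eigenspace)
  have "fibre_map m P (- s) \<mu> x (fibre_map m P s \<nu> x w)
      = split_parts (R s x) (proj x) s \<mu> (turn (R (- s) x) (cl b) (- s) x t)"
    using parts by (simp add: fibre_map_def[of m P "- s"] f b_def)
  then show "fibre_map m P (- s) \<mu> x (fibre_map m P s \<nu> x w) = w"
    by (simp add: t u)
qed

end

text \<open>With \<open>s = sin 2\<theta>\<close> and \<open>cos 2\<theta>\<close> in place of the root, \<open>s + cos 2\<theta> cot t = cos (t - 2\<theta>) / sin t\<close>.\<close>

lemma tilted_principal_curvatures:
  assumes \<theta>: "0 < \<theta>" "\<theta> < pi / 4"
  defines "\<mu> k \<equiv> sin (2 * \<theta>) + sqrt (1 - (sin (2 * \<theta>))\<^sup>2) * principal_curvature \<theta> k"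
  shows "\<mu> 1 = cot \<theta>" "\<mu> 2 = 1" "\<mu> 3 = tan \<theta>" "\<mu> 4 = - 1"
proof -
  have pos: "sin \<theta> > 0" "cos \<theta> > 0" using \<theta> by (auto intro: sin_gt_zero cos_gt_zero)
  have "cos (2 * \<theta>) > 0" using \<theta> by (intro cos_gt_zero) auto
  then have c: "sqrt (1 - (sin (2 * \<theta>))\<^sup>2) = cos (2 * \<theta>)"
    by (simp add: cos_squared_eq[symmetric])
  have \<mu>: "\<mu> k = cos (t - 2 * \<theta>) / sin t"
    if "t = \<theta> + (real k - 1) / 4 * pi" "sin t \<noteq> 0" for k t
    using that(2) unfolding \<mu>_def c principal_curvature_def that(1)[symmetric] cot_def cos_diff
    by (simp add: field_simps)
  show "\<mu> 1 = cot \<theta>" using \<mu>[of \<theta> 1] pos by (simp add: cot_def)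
  have s4: "sin (\<theta> + pi / 4) > 0" using \<theta> by (intro sin_gt_zero) auto
  have "cos (\<theta> + pi / 4 - 2 * \<theta>) = sin (\<theta> + pi / 4)"
    by (simp add: sin_cos_eq algebra_simps)
  then show "\<mu> 2 = 1" using \<mu>[of "\<theta> + pi / 4" 2] s4 by simp
  have "cos (\<theta> + pi / 2 - 2 * \<theta>) = sin \<theta>" "sin (\<theta> + pi / 2) = cos \<theta>"
    by (simp_all add: sin_cos_eq algebra_simps sin_add)
  then show "\<mu> 3 = tan \<theta>" using \<mu>[of "\<theta> + pi / 2" 3] pos by (simp add: tan_def)
  have c4: "cos (\<theta> + pi / 4) > 0" using \<theta> by (intro cos_gt_zero) auto
  have "sin (\<theta> + 3 / 4 * pi) = cos (\<theta> + pi / 4)"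
    using sin_add[of "\<theta> + pi / 4" "pi / 2"] by (simp add: algebra_simps)
  moreover have "cos (\<theta> + 3 / 4 * pi - 2 * \<theta>) = - cos (\<theta> + pi / 4)"
    using cos_minus_pi[of "\<theta> + pi / 4"] cos_minus[of "\<theta> + 3 / 4 * pi - 2 * \<theta>"]
    by (simp add: algebra_simps)
  ultimately show "\<mu> 4 = - 1" using \<mu>[of "\<theta> + 3 / 4 * pi" 4] c4 by simp
qed

theorem theorem1p5:
  fixes P :: "nat \<Rightarrow> real^'n^'n" and m l :: nat and \<theta> :: real
  assumes "CARD('n) = 2 * l"
    and "clifford_system m P"
    and "0 < int m" and "0 < int l - int m - 1"
    and "0 < \<theta>" and "\<theta> < pi / 4"
    and "odd m"
  shows "\<exists>\<Phi>. vector_bundle_iso (FKM_hypersurface m P \<theta>)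
           (whitney_sum (principal_distribution m P \<theta> 1) (principal_distribution m P \<theta> 2))
           (whitney_sum (principal_distribution m P \<theta> 3) (principal_distribution m P \<theta> 4)) \<Phi>"
proof -
  interpret clifford m P by unfold_locales (rule assms)
  define s where "s = sin (2 * \<theta>)"
  have pos: "sin \<theta> > 0" "cos \<theta> > 0" "cos (2 * \<theta>) > 0" "s > 0"
    using assms by (auto simp: s_def intro: sin_gt_zero cos_gt_zero)
  have "s\<^sup>2 < 1" using pos(3) sin_cos_squared_add[of "2 * \<theta>"] unfolding s_def
    by (metis less_add_same_cancel1 zero_less_power)
  then have s: "s \<noteq> 0" "\<bar>s\<bar> < 1" using pos by (auto simp: abs_square_less_1)
  have s_eq: "s = 2 * sin \<theta> * cos \<theta>" by (simp add: s_def sin_double)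
  have neq: "(sin \<theta>)\<^sup>2 \<noteq> (cos \<theta>)\<^sup>2" using pos(3) by (simp add: cos_double)
  have \<mu>: "(cot \<theta>)\<^sup>2 \<noteq> 1" "s * ((cot \<theta>)\<^sup>2 + 1) = 2 * cot \<theta>"
  proof -
    show "(cot \<theta>)\<^sup>2 \<noteq> 1" using neq pos by (simp add: cot_def power_divide)
    have "(cot \<theta>)\<^sup>2 + 1 = 1 / (sin \<theta>)\<^sup>2"
      using pos sin_cos_squared_add[of \<theta>] by (simp add: cot_def field_simps)
    then show "s * ((cot \<theta>)\<^sup>2 + 1) = 2 * cot \<theta>"
      using pos by (simp add: s_eq cot_def power2_eq_square)
  qed
  have \<nu>: "(- tan \<theta>)\<^sup>2 \<noteq> 1" "- s * ((- tan \<theta>)\<^sup>2 + 1) = 2 * (- tan \<theta>)"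
  proof -
    show "(- tan \<theta>)\<^sup>2 \<noteq> 1" using neq pos by (simp add: tan_def power_divide)
    have "(- tan \<theta>)\<^sup>2 + 1 = 1 / (cos \<theta>)\<^sup>2"
      using pos sin_cos_squared_add[of \<theta>] by (simp add: tan_def field_simps)
    then show "- s * ((- tan \<theta>)\<^sup>2 + 1) = 2 * (- tan \<theta>)"
      using pos by (simp add: s_eq tan_def power2_eq_square)
  qed
  let ?E = "whitney_sum (principal_distribution m P \<theta> 1) (principal_distribution m P \<theta> 2)"
  let ?E' = "whitney_sum (principal_distribution m P \<theta> 3) (principal_distribution m P \<theta> 4)"
  let ?F = "fibre_map m P s (- tan \<theta>)" and ?G = "fibre_map m P (- s) (cot \<theta>)"
  have "vector_bundle_iso (FKM_hypersurface m P \<theta>) ?E ?E' (\<lambda>z. (fst z, ?F (fst z) (snd z)))"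
  proof (rule vector_bundle_isoI[where G = ?G])
    fix x w assume "x \<in> FKM_hypersurface m P \<theta>"
    then interpret FKM_point m P s x
      using s by (intro FKM_pointI) (auto simp: FKM_hypersurface_eq s_def)
    interpret N: FKM_point m P "- s" x by (rule opposite)
    have E: "?E x = leaf.eigenspace (cot \<theta>) \<times> leaf.eigenspace 1"
      "?E' x = leaf.eigenspace (tan \<theta>) \<times> leaf.eigenspace (- 1)"
      using tilted_principal_curvatures[OF assms(5,6)]
      by (simp_all add: whitney_sum_def principal_distribution_FKM[OF pos(4) s_def] flip: s_def)
    have N_eigen: "N.leaf.eigenspace r = leaf.eigenspace (- r)" for r
      by (rule opposite_eigenspace)
    show "?F x w \<in> ?E' x \<and> ?G x (?F x w) = w" if "w \<in> ?E x"
      using fibre_map_eigenspaces[OF assms(7) \<mu> \<nu>, of w] that unfolding E by simp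
    show "?G x w \<in> ?E x \<and> ?F x (?G x w) = w" if "w \<in> ?E' x"
      using N.fibre_map_eigenspaces[OF assms(7) \<nu>, of "cot \<theta>" w] \<mu> that unfolding E N_eigen by simp
  qed (intro smooth_map_fibre_map linear_fibre_map)+
  then show ?thesis by blast
qed

end
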